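(* Let $\Omega\subseteq\mathbb{O}$ be either a slice domain or a product domain and let $f:\Omega\to\mathbb{O}$ be a slice regular function. If $f$ is not slice constant, then its restriction to $$\Omega\setminus(\overline{D}_f\cup W_f)$$ is an open map (into $\mathbb{O}$). Moreover, if $W_f=\emptyset$, then the image $f(U)$ of any circular open subset $U$ of $\Omega$ is open; in particular, $f(\Omega)$ is open.
   Context: $\mathbb{O}$ is the real algebra of octonions, identified with $\mathbb{R}^8$, with conjugation $x\mapsto x^c$, $t(x)=x+x^c$, $n(x)=xx^c$, $\mathrm{Re}(x)=t(x)/2$, $\mathrm{Im}(x)=x-\mathrm{Re}(x)$; $\mathbb{S}=\{J\in\mathbb{O}: J^2=-1\}$; $\mathbb{C}_J=\mathbb{R}+J\mathbb{R}$ for $J\in\mathbb{S}$; for $x=\alpha+\beta J$, $\mathbb{S}_x=\alpha+\beta\mathbb{S}$. Circular sets. For a nonempty $D\subseteq\mathbb{C}$ invariant under complex conjugation, $\Omega_D=\{\alpha+\beta J:\alpha+i\beta\in D,\ J\in\mathbb{S}\}$. A set is circular if it has the form $\{\alpha+\beta J:\alpha+i\beta\in E, J\in\mathbb{S}\}$ for some $E\subseteq\mathbb{C}$. Write $\Omega=\Omega_D$, $\Omega_J=\Omega\cap\mathbb{C}_J$. When $D$ is open, $\Omega_D$ is a slice domain if $D$ is connected and meets $\mathbb{R}$; it is a product domain if $D\cap\mathbb{R}=\emptyset$ and $D$ has exactly two connected components, switched by complex conjugation; let $D^+$ denote the one in the open upper half-plane. Slice regular functions. Let $\mathbb{O}_{\mathbb{C}}=\mathbb{O}\otimes_{\mathbb{R}}\mathbb{C}=\{x+\imath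 y\}$ with $(x+\imath y)(x'+\imath y')=xx'-yy'+\imath(xy'+yx')$, $(x+\imath y)^c=x^c+\imath y^c$, $\overline{x+\imath y}=x-\imath y$. A stem function is a map $F=F_1+\imath F_2:D\to\mathbb{O}_{\mathbb{C}}$ with $F(\bar z)=\overline{F(z)}$; it induces the slice function $f=\mathcal{I}(F)$, $f(\alpha+\beta J)=F_1(\alpha+i\beta)+JF_2(\alpha+i\beta)$. If $\Omega$ is open, $f$ is slice regular when $F$ is $C^1$ and $\frac{\partial F}{\partial\alpha}+\imath\frac{\partial F}{\partial\beta}\equiv0$. Slice product: $\mathcal{I}(F)\cdot\mathcal{I}(G)=\mathcal{I}(FG)$; $\mathcal{I}(F)^c=\mathcal{I}(F^c)$; $N(f)=f\cdot f^c$. Spherical value: $f^\circ_s(x)=\frac12(f(x)+f(x^c))$; spherical derivative: $f'_s(x)=\frac12\mathrm{Im}(x)^{-1}(f(x)-f(x^c))$ for $x\in\Omega\setminus\mathbb{R}$. A slice regular $f$ is slice constant if $f_{|\Omega_J}$ is locally constant for each $J\in\mathbb{S}$. $D_f=\{x\in\Omega\setminus\mathbb{R}: f'_s(x)=0\}$ is the degenerate set and $\overline{D}_f$ is its closure in $\Omega$. Wings. Let $f$ be nonconstant and let $c\in f(\Omega)$ with $N(f-c)\equiv0$ (this can only occur if $\Omega=\Omega_D$ is a product domain). For $y\in\mathbb{O}$ let $\Delta_y(x)=x^2-x\,t(y)+n(y)$. For $z=\alpha+i\beta\in D^+$ and any $I\in\mathbb{S}$, let $n\ge0$ be the largest integer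 such that $f(x)-c=\Delta_{\alpha+\beta I}(x)^n h(x)$ for some slice regular $h:\Omega\to\mathbb{O}$; then $h'_s(\alpha+\beta I)\ne0$ and $h$ has exactly one zero in $\alpha+\beta\mathbb{S}$, namely $\omega(z)=\alpha-h^\circ_s(\alpha+\beta I)h'_s(\alpha+\beta I)^{-1}$ (independent of $I$). The wing is $W_{f,c}=\omega(D^+)$. $W_f$ is the union of all wings $W_{f,c}$ of $f$ over all such $c$ ($W_f=\emptyset$ if there are none). *)

theory Defs
  imports "HOL-Analysis.Analysis"
begin

section \<open>Octonions\<close>

text \<open>
  The Cayley--Dickson construction, applied twice to the complex numbers. The underlying type is
  an iterated product, so the library's topology, norm and inner product on it are those of the
  eight-dimensional Euclidean space. Products of pairs carry no multiplication in the library, so the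
  octonion product has its own symbol; it is neither commutative nor associative.
\<close>

type_synonym quaternion = "complex \<times> complex"
type_synonym octonion = "quaternion \<times> quaternion"

definition q_mult :: "quaternion \<Rightarrow> quaternion \<Rightarrow> quaternion" where
  "q_mult p q = (fst p * fst q - snd q * cnj (snd p), cnj (fst p) * snd q + fst q * snd p)"

definition q_cnj :: "quaternion \<Rightarrow> quaternion" where
  "q_cnj p = (cnj (fst p), - snd p)"

definition o_mult :: "octonion \<Rightarrow> octonion \<Rightarrow> octonion" (infixl "\<star>" 70) where
  "x \<star> y = (q_mult (fst x) (fst y) - q_mult (snd y) (q_cnj (snd x)),
            q_mult (q_cnj (fst x)) (snd y) + q_mult (fst y) (snd x))"

definition o_cnj :: "octonion \<Rightarrow> octonion" where
  "o_cnj x = (q_cnj (fst x), - snd x)"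

definition o_one :: octonion ("\<one>") where
  "\<one> = ((1, 0), (0, 0))"

primrec o_power :: "octonion \<Rightarrow> nat \<Rightarrow> octonion" where
  "o_power x 0 = \<one>"
| "o_power x (Suc n) = x \<star> o_power x n"

definition o_trace :: "octonion \<Rightarrow> octonion" where
  "o_trace x = x + o_cnj x"

definition o_sqnorm :: "octonion \<Rightarrow> octonion" where
  "o_sqnorm x = x \<star> o_cnj x"

definition o_Re :: "octonion \<Rightarrow> octonion" where
  "o_Re x = (1/2) *\<^sub>R o_trace x"

definition o_Im :: "octonion \<Rightarrow> octonion" where
  "o_Im x = x - o_Re x"

definition o_inverse :: "octonion \<Rightarrow> octonion" where
  "o_inverse x = (1 / (norm x)\<^sup>2) *\<^sub>R o_cnj x"

definition o_reals :: "octonion set" where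
  "o_reals = range (\<lambda>r. r *\<^sub>R \<one>)"

definition o_units :: "octonion set" ("\<S>") where
  "\<S> = {J. J \<star> J = - \<one>}"

text \<open>The point $\alpha + \beta J$ with $z = \alpha + i \beta$.\<close>

definition slice_pt :: "complex \<Rightarrow> octonion \<Rightarrow> octonion" where
  "slice_pt z J = Re z *\<^sub>R \<one> + Im z *\<^sub>R J"

definition slice_plane :: "octonion \<Rightarrow> octonion set" where
  "slice_plane J = range (\<lambda>z. slice_pt z J)"

definition \<Delta> :: "octonion \<Rightarrow> octonion \<Rightarrow> octonion" where
  "\<Delta> y x = x \<star> x - x \<star> o_trace y + o_sqnorm y"


section \<open>Circular sets and domains\<close>

definition circularization :: "complex set \<Rightarrow> octonion set" ("\<Omega>") where
  "\<Omega> D = {slice_pt z J | z J. z \<in> D \<and> J \<in> \<S>}"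

definition circular :: "octonion set \<Rightarrow> bool" where
  "circular U \<longleftrightarrow> (\<exists>E. U = \<Omega> E)"

text \<open>The next two predicates say of \<open>D\<close> that \<open>\<Omega> D\<close> is a slice (product) domain.\<close>

definition slice_domain :: "complex set \<Rightarrow> bool" where
  "slice_domain D \<longleftrightarrow>
     D \<noteq> {} \<and> cnj ` D = D \<and> open D \<and> connected D \<and> D \<inter> \<real> \<noteq> {}"

definition product_domain :: "complex set \<Rightarrow> bool" where
  "product_domain D \<longleftrightarrow>
     D \<noteq> {} \<and> cnj ` D = D \<and> open D \<and> D \<inter> \<real> = {} \<and>
     (\<exists>C C'. C \<noteq> C' \<and> components D = {C, C'} \<and> cnj ` C = C')"

definition upper_part :: "complex set \<Rightarrow> complex set" where
  "upper_part D = (THE C. C \<in> components D \<and> C \<subseteq> {z. 0 < Im z})"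


section \<open>Stem functions and slice functions\<close>

text \<open>The pair \<open>(x, y)\<close> stands for $x + \imath y$ in the complexified octonions.\<close>

type_synonym c_octonion = "octonion \<times> octonion"

definition c_mult :: "c_octonion \<Rightarrow> c_octonion \<Rightarrow> c_octonion" where
  "c_mult u v = (fst u \<star> fst v - snd u \<star> snd v, fst u \<star> snd v + snd u \<star> fst v)"

definition c_ocnj :: "c_octonion \<Rightarrow> c_octonion" where
  "c_ocnj u = (o_cnj (fst u), o_cnj (snd u))"

definition c_bar :: "c_octonion \<Rightarrow> c_octonion" where
  "c_bar u = (fst u, - snd u)"

definition c_iota :: "c_octonion \<Rightarrow> c_octonion" where
  "c_iota u = (- snd u, fst u)"

definition stem :: "complex set \<Rightarrow> (complex \<Rightarrow> c_octonion) \<Rightarrow> bool" where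
  "stem D F \<longleftrightarrow> (\<forall>z\<in>D. F (cnj z) = c_bar (F z))"

text \<open>
  The slice function induced by a stem function is computed from the representation
  $x = \alpha + \beta J$ with $\beta \ge 0$; at real \<open>x\<close> the second summand vanishes. The lemma
  \<open>induced_slice_pt\<close> below shows that every representation gives the same value.
\<close>

definition induced :: "(complex \<Rightarrow> c_octonion) \<Rightarrow> octonion \<Rightarrow> octonion" where
  "induced F x =
     (let z = Complex (x \<bullet> \<one>) (norm (o_Im x)); J = (1 / norm (o_Im x)) *\<^sub>R o_Im x
      in fst (F z) + J \<star> snd (F z))"

definition stem_for :: "complex set \<Rightarrow> (octonion \<Rightarrow> octonion) \<Rightarrow> (complex \<Rightarrow> c_octonion) \<Rightarrow> bool" where
  "stem_for D f F \<longleftrightarrow> stem D F \<and> (\<forall>x\<in>\<Omega> D. f x = induced F x)"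

text \<open>On \<open>D\<close> the stem function of a slice function is unique (lemma \<open>stem_of_eq\<close>).\<close>

definition stem_of :: "complex set \<Rightarrow> (octonion \<Rightarrow> octonion) \<Rightarrow> complex \<Rightarrow> c_octonion" where
  "stem_of D f = (SOME F. stem_for D f F)"

text \<open>
  $C^1$ is expressed through a continuous Frechet derivative over the reals, whose values at
  \<open>1\<close> and \<open>\<i>\<close> are the partial derivatives in $\alpha$ and $\beta$.
\<close>

definition holomorphic_stem :: "complex set \<Rightarrow> (complex \<Rightarrow> c_octonion) \<Rightarrow> bool" where
  "holomorphic_stem D F \<longleftrightarrow>
     (\<exists>F' :: complex \<Rightarrow> complex \<Rightarrow>\<^sub>L c_octonion.
        continuous_on D F' \<and>
        (\<forall>z\<in>D. (F has_derivative blinfun_apply (F' z)) (at z) \<and>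
               blinfun_apply (F' z) 1 + c_iota (blinfun_apply (F' z) \<i>) = 0))"

definition slice_regular :: "complex set \<Rightarrow> (octonion \<Rightarrow> octonion) \<Rightarrow> bool" where
  "slice_regular D f \<longleftrightarrow> (\<exists>F. stem_for D f F \<and> holomorphic_stem D F)"

definition slice_mult ::
    "complex set \<Rightarrow> (octonion \<Rightarrow> octonion) \<Rightarrow> (octonion \<Rightarrow> octonion) \<Rightarrow> octonion \<Rightarrow> octonion" where
  "slice_mult D f g = induced (\<lambda>z. c_mult (stem_of D f z) (stem_of D g z))"

definition slice_conj :: "complex set \<Rightarrow> (octonion \<Rightarrow> octonion) \<Rightarrow> octonion \<Rightarrow> octonion" where
  "slice_conj D f = induced (\<lambda>z. c_ocnj (stem_of D f z))"

definition slice_norm :: "complex set \<Rightarrow> (octonion \<Rightarrow> octonion) \<Rightarrow> octonion \<Rightarrow> octonion" where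
  "slice_norm D f = slice_mult D f (slice_conj D f)"

definition spherical_value :: "(octonion \<Rightarrow> octonion) \<Rightarrow> octonion \<Rightarrow> octonion" where
  "spherical_value f x = (1/2) *\<^sub>R (f x + f (o_cnj x))"

definition spherical_deriv :: "(octonion \<Rightarrow> octonion) \<Rightarrow> octonion \<Rightarrow> octonion" where
  "spherical_deriv f x = (1/2) *\<^sub>R (o_inverse (o_Im x) \<star> (f x - f (o_cnj x)))"

definition slice_constant :: "complex set \<Rightarrow> (octonion \<Rightarrow> octonion) \<Rightarrow> bool" where
  "slice_constant D f \<longleftrightarrow>
     (\<forall>J\<in>\<S>. \<forall>x\<in>\<Omega> D \<inter> slice_plane J.
        eventually (\<lambda>y. f y = f x) (at x within (\<Omega> D \<inter> slice_plane J)))"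


section \<open>Degenerate set and wings\<close>

definition degenerate_set :: "complex set \<Rightarrow> (octonion \<Rightarrow> octonion) \<Rightarrow> octonion set" where
  "degenerate_set D f = {x \<in> \<Omega> D - o_reals. spherical_deriv f x = 0}"

definition degenerate_closure :: "complex set \<Rightarrow> (octonion \<Rightarrow> octonion) \<Rightarrow> octonion set" where
  "degenerate_closure D f = \<Omega> D \<inter> closure (degenerate_set D f)"

definition factors_at ::
    "complex set \<Rightarrow> (octonion \<Rightarrow> octonion) \<Rightarrow> octonion \<Rightarrow> octonion \<Rightarrow> nat \<Rightarrow> (octonion \<Rightarrow> octonion) \<Rightarrow> bool"
  where
  "factors_at D f c y n h \<longleftrightarrow>
     slice_regular D h \<and> (\<forall>x\<in>\<Omega> D. f x - c = o_power (\<Delta> y x) n \<star> h x)"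

definition max_exponent :: "complex set \<Rightarrow> (octonion \<Rightarrow> octonion) \<Rightarrow> octonion \<Rightarrow> octonion \<Rightarrow> nat" where
  "max_exponent D f c y = (GREATEST n. \<exists>h. factors_at D f c y n h)"

text \<open>
  The value does not depend on \<open>I\<close>, and \<open>h\<close> is determined on \<open>\<Omega> D\<close> by the factorization.
\<close>

definition wing_point ::
    "complex set \<Rightarrow> (octonion \<Rightarrow> octonion) \<Rightarrow> octonion \<Rightarrow> complex \<Rightarrow> octonion" where
  "wing_point D f c z =
     (SOME w. \<exists>I\<in>\<S>. \<exists>h.
        factors_at D f c (slice_pt z I) (max_exponent D f c (slice_pt z I)) h \<and>
        w = Re z *\<^sub>R \<one> -
            spherical_value h (slice_pt z I) \<star> o_inverse (spherical_deriv h (slice_pt z I)))"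

definition wing :: "complex set \<Rightarrow> (octonion \<Rightarrow> octonion) \<Rightarrow> octonion \<Rightarrow> octonion set" where
  "wing D f c = wing_point D f c ` upper_part D"

definition wings :: "complex set \<Rightarrow> (octonion \<Rightarrow> octonion) \<Rightarrow> octonion set" where
  "wings D f =
     (\<Union>c\<in>{c \<in> f ` \<Omega> D. \<forall>x\<in>\<Omega> D. slice_norm D (\<lambda>y. f y - c) x = 0}. wing D f c)"


section \<open>Consistency of the definitions\<close>

lemmas o_defs = o_mult_def q_mult_def q_cnj_def o_cnj_def o_one_def o_trace_def o_sqnorm_def
  o_Re_def o_Im_def

lemma o_norm_eq: "x \<star> o_cnj x = (norm x)\<^sup>2 *\<^sub>R \<one>" "o_cnj x \<star> x = (norm x)\<^sup>2 *\<^sub>R \<one>"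
  unfolding power2_norm_eq_inner
  by (cases x; cases "fst x"; cases "snd x";
      auto simp: o_defs inner_complex_def complex_eq_iff scaleR_prod_def algebra_simps)+

lemma o_inverse:
  assumes "x \<noteq> 0"
  shows "x \<star> o_inverse x = \<one>" "o_inverse x \<star> x = \<one>"
proof -
  have s: "a \<star> (r *\<^sub>R b) = r *\<^sub>R (a \<star> b)" "(r *\<^sub>R a) \<star> b = r *\<^sub>R (a \<star> b)" for a b r
    by (auto simp: o_defs complex_eq_iff scaleR_prod_def algebra_simps)
  show "x \<star> o_inverse x = \<one>" "o_inverse x \<star> x = \<one>"
    using assms by (simp_all add: o_inverse_def s o_norm_eq)
qed

lemma o_mult_alternative: "x \<star> (x \<star> y) = (x \<star> x) \<star> y" "(y \<star> x) \<star> x = y \<star> (x \<star> x)"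
  by (simp_all add: o_defs complex_eq_iff algebra_simps)

lemma o_norm_mult: "norm (x \<star> y) = norm x * norm y"
proof -
  have "(norm (x \<star> y))\<^sup>2 = (norm x)\<^sup>2 * (norm y)\<^sup>2"
    unfolding power2_norm_eq_inner
    by (simp add: o_defs inner_complex_def inner_prod_def) algebra
  then show ?thesis
    by (metis norm_ge_zero power2_eq_imp_eq power_mult_distrib mult_nonneg_nonneg)
qed

lemma o_Re_eq: "o_Re x = (x \<bullet> \<one>) *\<^sub>R \<one>"
  by (simp add: o_defs prod_eq_iff inner_prod_def inner_complex_def complex_eq_iff)

lemma o_units_iff: "J \<in> \<S> \<longleftrightarrow> J \<bullet> \<one> = 0 \<and> norm J = 1"
proof -
  have sq: "J \<star> J = (2 * (J \<bullet> \<one>)) *\<^sub>R J - (J \<bullet> J) *\<^sub>R \<one>"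
    by (simp add: o_defs prod_eq_iff inner_prod_def inner_complex_def complex_eq_iff algebra_simps)
  have one: "\<one> \<bullet> \<one> = 1" "\<one> \<noteq> 0"
    by (simp_all add: o_one_def inner_prod_def prod_eq_iff)
  show ?thesis
  proof
    assume "J \<in> \<S>"
    then have eq: "(2 * (J \<bullet> \<one>)) *\<^sub>R J = (J \<bullet> J - 1) *\<^sub>R \<one>"
      using sq by (simp add: o_units_def algebra_simps)
    have 0: "J \<bullet> \<one> = 0"
    proof (rule ccontr)
      assume nz: "J \<bullet> \<one> \<noteq> 0"
      define s where "s = (J \<bullet> J - 1) / (2 * (J \<bullet> \<one>))"
      have "J = (1 / (2 * (J \<bullet> \<one>))) *\<^sub>R ((2 * (J \<bullet> \<one>)) *\<^sub>R J)"
        using nz by simp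
      then have J: "J = s *\<^sub>R \<one>"
        unfolding eq s_def by simp
      have "J \<star> J = (s * s) *\<^sub>R \<one>"
        unfolding sq using J one by (simp flip: scaleR_left_diff_distrib)
      then have "(s * s) *\<^sub>R \<one> = (-1) *\<^sub>R \<one>"
        using \<open>J \<in> \<S>\<close> by (simp add: o_units_def)
      then have "s * s = -1"
        using one(2) real_vector.scale_right_imp_eq by blast
      then show False
        by (metis not_square_less_zero neg_less_0_iff_less zero_less_one)
    qed
    then have "J \<bullet> J = 1" using eq one by simp
    then show "J \<bullet> \<one> = 0 \<and> norm J = 1" using 0 by (simp add: norm_eq_1)
  next
    assume "J \<bullet> \<one> = 0 \<and> norm J = 1"
    then show "J \<in> \<S>" using sq by (simp add: o_units_def norm_eq_1)
  qed
qed

lemma induced_slice_pt: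
  assumes "stem D F" "z \<in> D" "J \<in> \<S>"
  shows "induced F (slice_pt z J) = fst (F z) + J \<star> snd (F z)"
proof -
  have J: "J \<bullet> \<one> = 0" "norm J = 1" using assms(3) o_units_iff by auto
  have one: "\<one> \<bullet> \<one> = 1"
    by (simp add: o_one_def inner_prod_def)
  have re: "slice_pt z J \<bullet> \<one> = Re z"
    using J one by (simp add: slice_pt_def inner_add_left)
  have im: "o_Im (slice_pt z J) = Im z *\<^sub>R J"
    unfolding o_Im_def o_Re_eq re by (simp add: slice_pt_def)
  have bar: "F (cnj z) = c_bar (F z)" using assms by (simp add: stem_def)
  have neg: "(- a) \<star> (- b) = a \<star> b" "0 \<star> b = 0" "a \<star> 0 = 0" for a b
    by (simp_all add: o_defs complex_eq_iff prod_eq_iff)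
  consider "Im z > 0" | "Im z = 0" | "Im z < 0" by linarith
  then show ?thesis
  proof cases
    case 1
    then have "Complex (Re z) \<bar>Im z\<bar> = z" by (simp add: complex_eq_iff)
    with 1 show ?thesis by (simp add: induced_def re im J Let_def)
  next
    case 2
    then have z: "Complex (Re z) 0 = z" "cnj z = z" by (simp_all add: complex_eq_iff)
    then have "snd (F z) = - snd (F z)" using bar by (metis c_bar_def snd_conv)
    then have "2 *\<^sub>R snd (F z) = 0" unfolding scaleR_2 by (metis add.right_inverse)
    then have "snd (F z) = 0" by simp
    with 2 z show ?thesis by (simp add: induced_def re im J Let_def neg)
  next
    case 3
    then have z: "Complex (Re z) \<bar>Im z\<bar> = cnj z" by (simp add: complex_eq_iff)
    have "(1 / \<bar>Im z\<bar>) *\<^sub>R (Im z *\<^sub>R J) = - J" using 3 by simp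
    with 3 z show ?thesis by (simp add: induced_def re im J Let_def bar c_bar_def neg)
  qed
qed

lemma stem_of_eq:
  assumes "stem_for D f F" "z \<in> D"
  shows "stem_of D f z = F z"
proof -
  define G where "G = stem_of D f"
  have G: "stem_for D f G"
    unfolding G_def stem_of_def using assms(1) by (rule someI[of "stem_for D f"])
  define J :: octonion where "J = ((\<i>, 0), (0, 0))"
  have J: "J \<in> \<S>" "- J \<in> \<S>"
    by (simp_all add: J_def o_units_def o_defs)
  have eq: "fst (F z) + K \<star> snd (F z) = fst (G z) + K \<star> snd (G z)" if "K \<in> \<S>" for K
  proof -
    have "slice_pt z K \<in> \<Omega> D" using that assms(2) unfolding circularization_def by blast
    then have "induced F (slice_pt z K) = induced G (slice_pt z K)"
      using assms(1) G unfolding stem_for_def by metis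
    then show ?thesis
      using induced_slice_pt that assms G unfolding stem_for_def by metis
  qed
  have neg: "(- a) \<star> b = - (a \<star> b)" "\<one> \<star> a = a" for a b
    by (simp_all add: o_defs complex_eq_iff prod_eq_iff)
  have e1: "fst (F z) + J \<star> snd (F z) = fst (G z) + J \<star> snd (G z)"
    using eq[OF J(1)] .
  have e2: "fst (F z) - J \<star> snd (F z) = fst (G z) - J \<star> snd (G z)"
    using eq[OF J(2)] by (simp add: neg)
  have "2 *\<^sub>R fst (F z) = 2 *\<^sub>R fst (G z)"
    using arg_cong2[OF e1 e2, of "(+)"] by (simp add: scaleR_2)
  then have f: "fst (F z) = fst (G z)" by simp
  then have "J \<star> (J \<star> snd (F z)) = J \<star> (J \<star> snd (G z))" using e1 by simp
  then have "snd (F z) = snd (G z)"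
    using J(1) by (simp add: o_mult_alternative o_units_def neg)
  with f show ?thesis by (simp add: G_def prod_eq_iff)
qed

end

theory Submission
  imports Defs "HOL-Complex_Analysis.Complex_Analysis"
begin

text \<open>
  Let \<open>F\<close> be the stem function of \<open>f\<close>. On the sphere through \<open>z\<close>, the function \<open>f\<close> takes the value \<open>c\<close>
  if and only if the complex number \<open>stem_norm F c z\<close> vanishes, and \<open>stem_norm F c\<close> is holomorphic in \<open>z\<close>.
  Hence, if \<open>stem_norm F c\<close> is not identically zero, Hurwitz' theorem shows that the values near \<open>c\<close> are
  attained on spheres near \<open>z\<close>. Where \<open>F\<close> has a nonzero second component, the point on the
  sphere depends continuously on \<open>z\<close> and \<open>c\<close>, which makes \<open>f\<close> open there. The values \<open>c\<close> with
  \<open>stem_norm F c\<close> identically zero form a closed set, and away from the degenerate set the wings are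
  exactly the preimage of this set: after division by the highest power of \<open>\<Delta>\<close>, the stem function
  of the quotient does not vanish and still has null norm.
\<close>

section \<open>Octonions and slices\<close>

lemma o_mult_linear:
  "(x + y) \<star> z = x \<star> z + y \<star> z" "x \<star> (y + z) = x \<star> y + x \<star> z"
  "(x - y) \<star> z = x \<star> z - y \<star> z" "x \<star> (y - z) = x \<star> y - x \<star> z"
  "(r *\<^sub>R x) \<star> y = r *\<^sub>R (x \<star> y)" "x \<star> (r *\<^sub>R y) = r *\<^sub>R (x \<star> y)"
  "(- x) \<star> y = - (x \<star> y)" "x \<star> (- y) = - (x \<star> y)"
  "0 \<star> y = 0" "x \<star> 0 = 0"
  by (simp_all add: o_defs prod_eq_iff complex_eq_iff algebra_simps)

lemma o_mult_one [simp]: "\<one> \<star> x = x" "x \<star> \<one> = x"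
  by (simp_all add: o_defs prod_eq_iff)

lemma o_one_inner [simp]: "\<one> \<bullet> \<one> = 1"
  by (simp add: o_one_def inner_prod_def)

lemma o_cnj_linear:
  "o_cnj (x + y) = o_cnj x + o_cnj y" "o_cnj (r *\<^sub>R x) = r *\<^sub>R o_cnj x"
  by (simp_all add: o_defs prod_eq_iff complex_eq_iff)

lemma norm_o_cnj [simp]: "norm (o_cnj x) = norm x"
  by (simp add: o_defs norm_prod_def)

lemma o_cnj_eq: "o_cnj x = (2 * (x \<bullet> \<one>)) *\<^sub>R \<one> - x"
  by (simp add: o_defs prod_eq_iff inner_prod_def inner_complex_def complex_eq_iff)

text \<open>This is \<open>o_norm_mult\<close> polarized in the left factor against
  \<open>\<one>\<close>. For \<open>x\<close> in \<open>\<S>\<close> it makes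
  \<open>x \<star> y\<close> orthogonal to \<open>y\<close>.\<close>

lemma inner_o_mult_left: "(x \<star> y) \<bullet> y = (x \<bullet> \<one>) * (y \<bullet> y)"
  by (simp add: o_defs inner_prod_def inner_complex_def algebra_simps)

text \<open>Right multiplication by \<open>o_cnj y\<close> is adjoint to right multiplication by
  \<open>y\<close>; hence a quotient is purely imaginary when its terms are orthogonal.\<close>

lemma inner_mult_o_cnj: "(x \<star> o_cnj y) \<bullet> \<one> = x \<bullet> y"
  by (simp add: o_defs inner_prod_def inner_complex_def algebra_simps)

text \<open>Since \<open>o_cnj y\<close> is a real combination of \<open>\<one>\<close> and
  \<open>y\<close>, the right alternative law does the work of associativity.\<close>

lemma o_mult_cnj_cancel: "(x \<star> o_cnj y) \<star> y = (norm y)\<^sup>2 *\<^sub>R x"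
proof -
  have "x \<star> o_cnj y = (2 * (y \<bullet> \<one>)) *\<^sub>R x - x \<star> y"
    by (simp add: o_cnj_eq o_mult_linear)
  then have "(x \<star> o_cnj y) \<star> y = (2 * (y \<bullet> \<one>)) *\<^sub>R (x \<star> y) - x \<star> (y \<star> y)"
    by (simp add: o_mult_linear o_mult_alternative)
  also have "\<dots> = x \<star> (o_cnj y \<star> y)"
    by (simp add: o_cnj_eq o_mult_linear)
  finally show ?thesis by (simp add: o_norm_eq o_mult_linear)
qed

lemma o_inverse_cancel:
  assumes "y \<noteq> 0"
  shows "(x \<star> o_inverse y) \<star> y = x"
  using assms by (simp add: o_inverse_def o_mult_linear o_mult_cnj_cancel)

lemma o_mult_cancel_right:
  assumes "y \<noteq> 0" "x \<star> y = z \<star> y"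
  shows "x = z"
proof -
  have "norm ((x - z) \<star> y) = 0" using assms by (simp add: o_mult_linear)
  then show ?thesis using assms(1) by (simp only: o_norm_mult) simp
qed

lemma units_nonempty: "((\<i>, 0), (0, 0)) \<in> \<S>"
  by (simp add: o_units_def o_defs)

lemma units_uminus: "J \<in> \<S> \<Longrightarrow> - J \<in> \<S>"
  by (simp add: o_units_def o_mult_linear)

lemma units_mult_twice: "J \<in> \<S> \<Longrightarrow> J \<star> (J \<star> x) = - x"
  by (simp add: o_mult_alternative o_units_def o_mult_linear)

text \<open>By \<open>o_units_iff\<close>, multiplicativity of the norm gives length 1 and
  \<open>inner_mult_o_cnj\<close> gives orthogonality to \<open>\<one>\<close>. The sign makes the
  quotient the \<open>J\<close> that solves \<open>a + J \<star> b = 0\<close>.\<close>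

lemma units_quotient:
  assumes "b \<noteq> 0" "norm a = norm b" "a \<bullet> b = 0"
  shows "- (a \<star> o_inverse b) \<in> \<S>"
proof -
  have "norm (a \<star> o_inverse b) = 1"
    using assms by (simp add: o_norm_mult o_inverse_def power2_eq_square)
  moreover have "(a \<star> o_inverse b) \<bullet> \<one> = 0"
    using assms by (simp add: o_inverse_def o_mult_linear inner_mult_o_cnj)
  ultimately show ?thesis by (simp add: o_units_iff)
qed

text \<open>The values of a slice function on the sphere through \<open>z\<close> are \<open>a + J \<star> b\<close> with
  \<open>a + \<iota> b\<close> the value of the stem function at \<open>z\<close>; they form the sphere with centre \<open>a\<close> and
  radius \<open>norm b\<close> in the hyperplane through \<open>a\<close> orthogonal to \<open>b\<close>.\<close>

lemma slice_sphere_image: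
  "(\<exists>J\<in>\<S>. c = a + J \<star> b) \<longleftrightarrow> norm (a - c) = norm b \<and> (a - c) \<bullet> b = 0"
proof
  assume "\<exists>J\<in>\<S>. c = a + J \<star> b"
  then obtain J where J: "J \<in> \<S>" "c = a + J \<star> b" by blast
  then show "norm (a - c) = norm b \<and> (a - c) \<bullet> b = 0"
    by (simp add: o_norm_mult inner_o_mult_left o_units_iff)
next
  assume *: "norm (a - c) = norm b \<and> (a - c) \<bullet> b = 0"
  show "\<exists>J\<in>\<S>. c = a + J \<star> b"
  proof (cases "b = 0")
    case True
    then show ?thesis using * units_nonempty by (auto simp: o_mult_linear)
  next
    case False
    have "- ((a - c) \<star> o_inverse b) \<star> b = c - a"
      using False by (simp add: o_inverse_cancel o_mult_linear)
    then show ?thesis using units_quotient[OF False] *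
      by (intro bexI[of _ "- ((a - c) \<star> o_inverse b)"]) auto
  qed
qed

section \<open>Points of slices and circular sets\<close>

lemma slice_pt_inner_one: "J \<in> \<S> \<Longrightarrow> slice_pt z J \<bullet> \<one> = Re z"
  by (simp add: slice_pt_def inner_add_left o_units_iff)

lemma o_Im_slice_pt: "J \<in> \<S> \<Longrightarrow> o_Im (slice_pt z J) = Im z *\<^sub>R J"
  unfolding o_Im_def o_Re_eq by (simp add: slice_pt_inner_one) (simp add: slice_pt_def)

lemma slice_pt_cnj: "slice_pt (cnj z) J = slice_pt z (- J)"
  by (simp add: slice_pt_def)

lemma o_cnj_slice_pt: "J \<in> \<S> \<Longrightarrow> o_cnj (slice_pt z J) = slice_pt z (- J)"
  unfolding o_cnj_eq by (simp add: slice_pt_inner_one) (simp add: slice_pt_def algebra_simps scaleR_2 flip: scaleR_scaleR)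

text \<open>For fixed \<open>J\<close> in \<open>\<S>\<close>, \<open>slice_pt\<close> embeds the
  complex numbers as a subalgebra; this moves computations inside one slice into complex
  arithmetic.\<close>

lemma slice_pt_mult:
  assumes "J \<in> \<S>"
  shows "slice_pt z J \<star> slice_pt w J = slice_pt (z * w) J"
proof -
  have "J \<star> J = - \<one>" using assms by (simp add: o_units_def)
  then show ?thesis by (simp add: slice_pt_def o_mult_linear algebra_simps)
qed

lemma o_power_slice_pt: "J \<in> \<S> \<Longrightarrow> o_power (slice_pt z J) n = slice_pt (z ^ n) J"
  by (induction n) (simp_all add: slice_pt_mult, simp add: slice_pt_def)

lemma norm_slice_pt:
  assumes "J \<in> \<S>" shows "norm (slice_pt z J) = norm z"
proof -
  have "J \<bullet> J = 1" "J \<bullet> \<one> = 0" using assms by (simp_all add: o_units_iff norm_eq_1)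
  then have "(norm (slice_pt z J))\<^sup>2 = (norm z)\<^sup>2"
    unfolding cmod_power2 power2_norm_eq_inner slice_pt_def
    by (simp add: inner_add_left inner_add_right inner_commute power2_eq_square)
  then show ?thesis by (simp add: power2_eq_iff_nonneg)
qed

text \<open>The coefficients of \<open>\<Delta>\<close> are real, so on every slice it acts as the
  real quadratic polynomial with roots \<open>w\<close> and \<open>cnj w\<close>, whatever
  \<open>I\<close> is.\<close>

lemma \<Delta>_slice_pt:
  assumes "J \<in> \<S>" "I \<in> \<S>"
  shows "\<Delta> (slice_pt w I) (slice_pt z J) = slice_pt ((z - w) * (z - cnj w)) J"
proof -
  have "o_trace (slice_pt w I) = (2 * Re w) *\<^sub>R \<one>"
    using assms by (simp add: o_trace_def o_cnj_eq slice_pt_inner_one)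
  moreover have "o_sqnorm (slice_pt w I) = (norm w)\<^sup>2 *\<^sub>R \<one>"
    using assms by (simp add: o_sqnorm_def o_norm_eq norm_slice_pt)
  moreover have "(z - w) * (z - cnj w) = z * z - of_real (2 * Re w) * z + of_real ((norm w)\<^sup>2)"
    unfolding cmod_power2 by (simp add: complex_eq_iff power2_eq_square algebra_simps)
  ultimately show ?thesis
    unfolding \<Delta>_def by (simp add: slice_pt_mult assms o_mult_linear)
      (simp add: slice_pt_def algebra_simps)
qed

text \<open>The representation with nonnegative imaginary part, as in \<open>induced\<close>. At
  real points any unit may serve as \<open>J\<close>.\<close>

lemma octonion_eq_slice_pt:
  obtains J where "J \<in> \<S>" "x = slice_pt (Complex (x \<bullet> \<one>) (norm (o_Im x))) J"
proof (cases "o_Im x = 0")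
  case True
  then have "x = (x \<bullet> \<one>) *\<^sub>R \<one>" by (simp add: o_Im_def o_Re_eq)
  with True show ?thesis by (intro that[OF units_nonempty]) (simp add: slice_pt_def flip: zero_prod_def)
next
  case False
  have "(1 / norm (o_Im x)) *\<^sub>R o_Im x \<in> \<S>"
    using False by (simp add: o_units_iff) (simp add: o_Im_def o_Re_eq inner_diff_left)
  from that[OF this] show ?thesis using False
    by (simp add: slice_pt_def) (simp add: o_Im_def o_Re_eq)
qed

lemma slice_pt_eqD:
  assumes "J \<in> \<S>" "I \<in> \<S>" "slice_pt z J = slice_pt w I"
  shows "w = z \<or> w = cnj z"
proof -
  have "Re z = Re w" using assms by (metis slice_pt_inner_one)
  moreover have "Im z *\<^sub>R J = Im w *\<^sub>R I" using assms by (metis o_Im_slice_pt)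
  then have "\<bar>Im z\<bar> = \<bar>Im w\<bar>" using assms by (metis norm_scaleR o_units_iff mult.right_neutral)
  then have "Im w = Im z \<or> Im w = - Im z" by linarith
  ultimately show ?thesis by (simp add: complex_eq_iff)
qed

text \<open>The two alternatives reflect that \<open>E\<close> may be asymmetric, as
  \<open>circular\<close> permits, while \<open>J\<close> and \<open>- J\<close> describe the same
  slice.\<close>

lemma slice_pt_in_circularization_iff:
  assumes "J \<in> \<S>"
  shows "slice_pt z J \<in> \<Omega> E \<longleftrightarrow> z \<in> E \<or> cnj z \<in> E"
proof
  assume "slice_pt z J \<in> \<Omega> E"
  then show "z \<in> E \<or> cnj z \<in> E"
    using slice_pt_eqD[OF assms] unfolding circularization_def by blast
next
  have "slice_pt z J = slice_pt (cnj z) (- J)" by (simp add: slice_pt_cnj)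
  then show "slice_pt z J \<in> \<Omega> E" if "z \<in> E \<or> cnj z \<in> E"
    using that assms units_uminus unfolding circularization_def by blast
qed

lemma slice_pt_in_circularization:
  assumes "cnj ` D = D" "J \<in> \<S>"
  shows "slice_pt z J \<in> \<Omega> D \<longleftrightarrow> z \<in> D"
  using assms(1) unfolding slice_pt_in_circularization_iff[OF assms(2)]
  by (metis complex_cnj_cnj imageI)

text \<open>Membership depends only on the real part and the length of the imaginary part. As a
  preimage under a continuous map, the set is open when \<open>D\<close> is.\<close>

lemma circularization_eq_vimage:
  assumes "cnj ` D = D"
  shows "\<Omega> D = (\<lambda>x. Complex (x \<bullet> \<one>) (norm (o_Im x))) -` D"
proof -
  have "x \<in> \<Omega> D \<longleftrightarrow> Complex (x \<bullet> \<one>) (norm (o_Im x)) \<in> D" for x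
    by (metis octonion_eq_slice_pt slice_pt_in_circularization[OF assms])
  then show ?thesis by auto
qed

lemma open_circularization:
  assumes "cnj ` D = D" "open D"
  shows "open (\<Omega> D)"
  unfolding circularization_eq_vimage[OF assms(1)]
proof (rule open_vimage[OF assms(2)])
  show "continuous_on UNIV (\<lambda>x. Complex (x \<bullet> \<one>) (norm (o_Im x)))"
    unfolding complex_eq o_Im_def o_Re_eq by (auto intro!: continuous_intros)
qed

section \<open>Stem functions as families of holomorphic functions\<close>

text \<open>The complex-linear extension of the functional \<open>inner v\<close>, applied to
  \<open>F z\<close>. It turns statements about stem functions into statements about scalar
  holomorphic functions.\<close>

definition stem_comp :: "(complex \<Rightarrow> c_octonion) \<Rightarrow> octonion \<Rightarrow> complex \<Rightarrow> complex" where
  "stem_comp F v z = Complex (fst (F z) \<bullet> v) (snd (F z) \<bullet> v)"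

text \<open>The complex number \<open>p + \<i> q\<close> such that \<open>c_mult u (c_ocnj u) = (p *\<^sub>R \<one>, q *\<^sub>R \<one>)\<close>
  for \<open>u = F z - c\<close>.\<close>

definition stem_norm :: "(complex \<Rightarrow> c_octonion) \<Rightarrow> octonion \<Rightarrow> complex \<Rightarrow> complex" where
  "stem_norm F c z = Complex ((norm (fst (F z) - c))\<^sup>2 - (norm (snd (F z)))\<^sup>2)
                             (2 * ((fst (F z) - c) \<bullet> snd (F z)))"

lemma stem_comp_eqI:
  assumes "\<And>b. b \<in> Basis \<Longrightarrow> stem_comp F b z = stem_comp G b w"
  shows "F z = G w"
proof (rule prod_eqI)
  show "fst (F z) = fst (G w)"
    using assms by (intro euclidean_eqI[of "fst (F z)"]) (simp only: stem_comp_def complex.inject)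
  show "snd (F z) = snd (G w)"
    using assms by (intro euclidean_eqI[of "snd (F z)"]) (simp only: stem_comp_def complex.inject)
qed

lemma stem_comp_minus_const:
  "stem_comp (\<lambda>z. (fst (F z) - c, snd (F z))) v z = stem_comp F v z - of_real (c \<bullet> v)"
  by (simp add: stem_comp_def inner_diff_left complex_eq_iff)

lemma stem_comp_bar:
  assumes "stem D F" "z \<in> D"
  shows "stem_comp F v (cnj z) = cnj (stem_comp F v z)"
  using assms by (simp add: stem_def stem_comp_def c_bar_def complex_eq_iff)

lemma stem_norm_bar:
  assumes "stem D F" "z \<in> D"
  shows "stem_norm F c (cnj z) = cnj (stem_norm F c z)"
  using assms by (simp add: stem_def stem_norm_def c_bar_def complex_eq_iff)

text \<open>Taking a coordinate turns \<open>c_iota\<close> into multiplication by the imaginary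
  unit, so the equation in \<open>holomorphic_stem\<close> becomes the Cauchy-Riemann
  equations.\<close>

lemma stem_comp_holomorphic:
  assumes "holomorphic_stem D F"
  shows "stem_comp F v holomorphic_on D"
proof -
  obtain F' :: "complex \<Rightarrow> complex \<Rightarrow>\<^sub>L c_octonion" where F':
    "\<And>z. z \<in> D \<Longrightarrow> (F has_derivative blinfun_apply (F' z)) (at z)"
    "\<And>z. z \<in> D \<Longrightarrow> blinfun_apply (F' z) 1 + c_iota (blinfun_apply (F' z) \<i>) = 0"
    using assms unfolding holomorphic_stem_def by blast
  have "(stem_comp F v has_field_derivative stem_comp (blinfun_apply (F' z)) v 1) (at z)"
    if z: "z \<in> D" for z
  proof -
    have i: "snd (blinfun_apply (F' z) 1) = - fst (blinfun_apply (F' z) \<i>)"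
      "fst (blinfun_apply (F' z) 1) = snd (blinfun_apply (F' z) \<i>)"
      using F'(2)[OF z] by (auto simp: c_iota_def prod_eq_iff add_eq_0_iff2)
    have lin: "blinfun_apply (F' z) h = Re h *\<^sub>R blinfun_apply (F' z) 1 + Im h *\<^sub>R blinfun_apply (F' z) \<i>" for h
    proof -
      have "h = Re h *\<^sub>R 1 + Im h *\<^sub>R \<i>" by (simp add: complex_eq_iff)
      then show ?thesis by (metis blinfun.add_right blinfun.scaleR_right)
    qed
    have "((\<lambda>w. of_real (fst (F w) \<bullet> v) + \<i> * of_real (snd (F w) \<bullet> v)) has_derivative
      (\<lambda>h. of_real (fst (blinfun_apply (F' z) h) \<bullet> v) + \<i> * of_real (snd (blinfun_apply (F' z) h) \<bullet> v))) (at z)"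
      by (auto intro!: derivative_eq_intros F'(1)[OF z])
    moreover have "of_real (fst (blinfun_apply (F' z) h) \<bullet> v) + \<i> * of_real (snd (blinfun_apply (F' z) h) \<bullet> v)
       = stem_comp (blinfun_apply (F' z)) v 1 * h" for h
      unfolding stem_comp_def lin[of h]
      by (simp add: inner_add_left complex_eq_iff i algebra_simps)
    moreover have "stem_comp F v = (\<lambda>w. of_real (fst (F w) \<bullet> v) + \<i> * of_real (snd (F w) \<bullet> v))"
      by (simp add: stem_comp_def fun_eq_iff complex_eq_iff)
    ultimately show ?thesis
      unfolding has_field_derivative_def by simp
  qed
  then show ?thesis using holomorphic_on_def field_differentiable_def
    by (metis has_field_derivative_at_within)
qed

text \<open>Inverse to taking the coordinates along \<open>Basis\<close>; it rebuilds a stem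
  function after its coordinates have been divided one by one.\<close>

definition stem_assemble :: "(octonion \<Rightarrow> complex \<Rightarrow> complex) \<Rightarrow> complex \<Rightarrow> c_octonion" where
  "stem_assemble g z = (\<Sum>b\<in>Basis. Re (g b z) *\<^sub>R b, \<Sum>b\<in>Basis. Im (g b z) *\<^sub>R b)"

lemma stem_comp_assemble:
  assumes "b \<in> Basis"
  shows "stem_comp (stem_assemble g) b z = g b z"
  using assms by (simp add: stem_comp_def stem_assemble_def complex_eq_iff)

lemma holomorphic_stem_assemble:
  assumes "open D" and hol: "\<And>b. b \<in> Basis \<Longrightarrow> g b holomorphic_on D"
  shows "holomorphic_stem D (stem_assemble g)"
proof -
  define L :: "octonion \<Rightarrow> complex \<Rightarrow>\<^sub>L c_octonion" where
    "L b = Blinfun (\<lambda>w. (Re w *\<^sub>R b, Im w *\<^sub>R b))" for b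
  have L: "blinfun_apply (L b) w = (Re w *\<^sub>R b, Im w *\<^sub>R b)" for b w
    unfolding L_def by (subst bounded_linear_Blinfun_apply)
      (auto intro!: bounded_linear_intros bounded_linear_Pair bounded_linear_Re bounded_linear_Im)
  have asm: "stem_assemble g = (\<lambda>z. \<Sum>b\<in>Basis. blinfun_apply (L b) (g b z))"
    by (auto simp: stem_assemble_def L fst_sum snd_sum prod_eq_iff)
  \<comment> \<open>Each summand multiplies by the complex derivative and then embeds along
    \<open>b\<close>; continuity in \<open>z\<close> is inherited from
    \<open>deriv (g b)\<close>.\<close>
  define F' where "F' z = (\<Sum>b\<in>Basis. L b o\<^sub>L blinfun_mult_right (deriv (g b) z))" for z
  have F': "blinfun_apply (F' z) h = (\<Sum>b\<in>Basis. blinfun_apply (L b) (deriv (g b) z * h))" for z h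
    by (simp add: F'_def blinfun.sum_left)
  have "continuous_on D F'"
    unfolding F'_def
    by (intro continuous_intros holomorphic_on_imp_continuous_on holomorphic_deriv hol assms)
  moreover have "(stem_assemble g has_derivative blinfun_apply (F' z)) (at z)" if "z \<in> D" for z
  proof -
    have "(g b has_derivative (\<lambda>h. deriv (g b) z * h)) (at z)" if "b \<in> Basis" for b
      using holomorphic_derivI[OF hol[OF that] assms(1) \<open>z \<in> D\<close>]
      by (simp add: has_field_derivative_def)
    then show ?thesis
      unfolding asm F' by (intro has_derivative_sum) (rule bounded_linear.has_derivative[OF blinfun.bounded_linear_right])
  qed
  moreover have "blinfun_apply (F' z) 1 + c_iota (blinfun_apply (F' z) \<i>) = 0" for z
    by (simp add: F' L c_iota_def prod_eq_iff fst_sum snd_sum sum_negf flip: sum.distrib)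
  ultimately show ?thesis unfolding holomorphic_stem_def by blast
qed

lemma stem_assemble_stem:
  assumes "cnj ` D = D" and "\<And>b z. b \<in> Basis \<Longrightarrow> z \<in> D \<Longrightarrow> g b (cnj z) = cnj (g b z)"
  shows "stem D (stem_assemble g)"
  using assms by (simp add: stem_def stem_assemble_def c_bar_def sum_negf)

text \<open>The complex-bilinear extension of the inner product is a sum of squares of coordinates.
  This shows holomorphy in \<open>z\<close>, continuity in \<open>c\<close>, and how a scalar factor
  comes out squared.\<close>

lemma stem_norm_eq_sum:
  "stem_norm F c z = (\<Sum>b\<in>Basis. (stem_comp F b z - of_real (c \<bullet> b))\<^sup>2)"
proof -
  have "(\<Sum>b\<in>Basis. (stem_comp F b z - of_real (c \<bullet> b))\<^sup>2) =
        (\<Sum>b\<in>Basis. Complex (((fst (F z) - c) \<bullet> b)\<^sup>2 - (snd (F z) \<bullet> b)\<^sup>2)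
           (2 * (((fst (F z) - c) \<bullet> b) * (snd (F z) \<bullet> b))))"
    by (rule sum.cong) (auto simp: stem_comp_def complex_eq_iff inner_diff_left power2_eq_square)
  also have "\<dots> = stem_norm F c z"
    unfolding stem_norm_def euclidean_inner[of "fst (F z) - c" "snd (F z)"] power2_norm_eq_inner
      euclidean_inner[of "fst (F z) - c" "fst (F z) - c"] euclidean_inner[of "snd (F z)" "snd (F z)"]
    by (simp add: complex_eq_iff sum_subtractf sum_distrib_left power2_eq_square)
  finally show ?thesis by simp
qed

lemma stem_norm_holomorphic:
  assumes "holomorphic_stem D F"
  shows "stem_norm F c holomorphic_on D"
  unfolding stem_norm_eq_sum by (intro holomorphic_intros stem_comp_holomorphic assms)

lemma stem_norm_eq_0_iff:
  "stem_norm F c z = 0 \<longleftrightarrow>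
     norm (fst (F z) - c) = norm (snd (F z)) \<and> (fst (F z) - c) \<bullet> snd (F z) = 0"
  by (auto simp: stem_norm_def complex_eq_iff power2_eq_iff_nonneg)

text \<open>Expanding the square isolates the dependence on the constant: apart from a term free of
  \<open>z\<close>, it is linear in \<open>c - d\<close>. This drives the uniform estimate for
  Hurwitz' theorem.\<close>

lemma stem_norm_change_const:
  "stem_norm F c z = stem_norm F d z - 2 * stem_comp F (c - d) z + of_real ((norm c)\<^sup>2 - (norm d)\<^sup>2)"
proof -
  have "(norm (a - b))\<^sup>2 = a \<bullet> a - 2 * (a \<bullet> b) + b \<bullet> b" for a b :: octonion
    by (simp only: power2_norm_eq_inner inner_diff_left inner_diff_right inner_commute[of b a])
  moreover have "snd (F z) \<bullet> (c - d) = c \<bullet> snd (F z) - d \<bullet> snd (F z)"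
    by (simp only: inner_diff_right inner_commute[of "snd (F z)"])
  ultimately show ?thesis
    unfolding stem_norm_def stem_comp_def
    by (simp add: complex_eq_iff inner_diff_left inner_diff_right power2_norm_eq_inner)
qed

lemma holomorphic_stem_continuous:
  assumes "holomorphic_stem D F"
  shows "continuous_on D F"
proof (rule continuous_at_imp_continuous_on, rule ballI)
  fix z assume "z \<in> D"
  then obtain F' where "(F has_derivative F') (at z)"
    using assms unfolding holomorphic_stem_def by blast
  then show "isCont F z" by (rule has_derivative_continuous)
qed

section \<open>Domains and the identity principle\<close>

text \<open>A component avoids the real axis and is connected, so the imaginary part has one sign on
  it; conjugation exchanges the signs. Hence the description in \<open>upper_part\<close> is
  satisfied by exactly one component.\<close>

lemma product_domain_upper_part:
  assumes "product_domain D"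
  shows "upper_part D = D \<inter> {z. 0 < Im z}" "connected (upper_part D)" "upper_part D \<noteq> {}"
proof -
  obtain A B where AB: "A \<noteq> B" "components D = {A, B}" "cnj ` A = B"
    and D: "D \<inter> \<real> = {}" using assms unfolding product_domain_def by (elim conjE exE)
  have BA: "cnj ` B = A" unfolding AB(3)[symmetric] by (simp add: image_image)
  obtain C where C: "components D = {C, cnj ` C}" "C \<subseteq> {z. 0 < Im z}"
  proof -
    have conn: "connected (Im ` A)" and sub: "A \<subseteq> D"
      using AB(2) in_components_connected[of A D] in_components_subset[of A D]
      by (auto intro!: connected_continuous_image continuous_intros)
    have "0 \<notin> Im ` A" using D sub by (auto simp: complex_is_Real_iff)
    then have "Im ` A \<subseteq> {0<..} \<or> Im ` A \<subseteq> {..<0}"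
      using connected_contains_Icc[OF conn]
      by (smt (verit, ccfv_SIG) atLeastAtMost_iff greaterThan_iff lessThan_iff subset_iff)
    then show ?thesis
    proof
      assume "Im ` A \<subseteq> {0<..}"
      then show ?thesis using that[of A] AB by auto
    next
      assume "Im ` A \<subseteq> {..<0}"
      then show ?thesis using that[of B] AB BA by fastforce
    qed
  qed
  have ne: "C \<noteq> {}" and conn: "connected C"
    using C(1) in_components_nonempty in_components_connected by blast+
  have D_eq: "D = C \<union> cnj ` C" using Union_components[of D] C by auto
  have "upper_part D = C"
    unfolding upper_part_def
  proof (rule the_equality)
    show "C \<in> components D \<and> C \<subseteq> {z. 0 < Im z}" using C by simp
  next
    fix E assume E: "E \<in> components D \<and> E \<subseteq> {z. 0 < Im z}"
    show "E = C"
    proof (rule ccontr)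
      assume "E \<noteq> C"
      then have "cnj ` C \<subseteq> {z. 0 < Im z}" using E C(1) by blast
      moreover obtain w where "w \<in> C" using ne by blast
      ultimately have "0 < Im (cnj w)" "0 < Im w" using C(2) by blast+
      then show False by simp
    qed
  qed
  moreover have "C = D \<inter> {z. 0 < Im z}" using D_eq C(2) by fastforce
  ultimately show "upper_part D = D \<inter> {z. 0 < Im z}" "connected (upper_part D)" "upper_part D \<noteq> {}"
    using ne conn by simp_all
qed

lemma domainD:
  assumes "slice_domain D \<or> product_domain D"
  shows "open D" "cnj ` D = D" "\<And>z. z \<in> D \<Longrightarrow> cnj z \<in> D"
  using assms by (auto simp: slice_domain_def product_domain_def)

text \<open>An identity principle that also covers the two components of a product domain: the
  symmetry of \<open>g\<close> carries zeros from one component to the other.\<close>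

lemma symmetric_holomorphic_eq_0:
  assumes dom: "slice_domain D \<or> product_domain D"
    and hol: "g holomorphic_on D" and sym: "\<And>z. z \<in> D \<Longrightarrow> g (cnj z) = cnj (g z)"
    and z0: "z0 \<in> D" "0 < r" "\<And>z. z \<in> D \<Longrightarrow> z \<in> ball z0 r \<Longrightarrow> g z = 0"
    and z: "z \<in> D"
  shows "g z = 0"
proof -
  have *: "g z = 0" if A: "open A" "connected A" "A \<subseteq> D" "w \<in> A" "z \<in> A"
    "\<And>z. z \<in> D \<Longrightarrow> z \<in> ball w r \<Longrightarrow> g z = 0" for A w z
  proof (rule analytic_continuation[of g A "A \<inter> ball w r" w])
    have "w \<in> interior (A \<inter> ball w r)" using A z0 by (simp add: interior_open)
    then show "w islimpt A \<inter> ball w r" using interior_limit_point by blast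
  qed (use A hol in \<open>auto intro: holomorphic_on_subset\<close>)
  show ?thesis
  proof (cases "slice_domain D")
    case True
    then show ?thesis using *[of D z0 z] z0 z by (auto simp: slice_domain_def)
  next
    case False
    with dom have P: "product_domain D" by simp
    define A where "A = upper_part D"
    have A: "A = D \<inter> {z. 0 < Im z}" "connected A"
      using product_domain_upper_part[OF P] by (simp_all add: A_def)
    have op: "open A" using domainD(1)[OF dom] A(1) by (simp add: open_Int open_halfspace_Im_gt)
    have Im: "Im w \<noteq> 0" if "w \<in> D" for w
      using P that by (auto simp: product_domain_def complex_is_Real_iff)
    \<comment> \<open>Here \<open>w\<close> is \<open>z0\<close> or its conjugate, whichever lies in
      the upper component.\<close>
    obtain w where w: "w \<in> A" "\<And>z. z \<in> D \<Longrightarrow> z \<in> ball w r \<Longrightarrow> g z = 0"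
    proof (cases "0 < Im z0")
      case True
      then show ?thesis using that[of z0] z0 A by auto
    next
      case False
      have "g z = 0" if "z \<in> D" "z \<in> ball (cnj z0) r" for z
      proof -
        have "dist z0 (cnj z) = dist (cnj z0) z" by (metis complex_cnj_cnj complex_cnj_diff complex_mod_cnj dist_norm)
        then have "g (cnj z) = 0" using z0(3) domainD(3)[OF dom] that by auto
        then show ?thesis using sym[OF that(1)] by simp
      qed
      moreover have "cnj z0 \<in> A" using False Im[OF z0(1)] A domainD(3)[OF dom z0(1)] by auto
      ultimately show ?thesis using that by blast
    qed
    have zero: "g z = 0" if "z \<in> A" for z
      using *[OF op A(2) _ w(1) that w(2)] A(1) by blast
    show ?thesis
    proof (cases "0 < Im z")
      case True then show ?thesis using zero z A by auto
    next
      case False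
      then have "cnj z \<in> A" using Im[OF z] A domainD(3)[OF dom z] by auto
      then show ?thesis using zero sym[OF z] by force
    qed
  qed
qed

text \<open>Hurwitz' theorem, applied to \<open>stem_norm F c\<close> as a family with parameter \<open>c\<close>.\<close>

lemma stem_norm_zero_stable:
  assumes dom: "slice_domain D \<or> product_domain D"
    and F: "holomorphic_stem D F" "stem D F"
    and z0: "z0 \<in> D" "stem_norm F c0 z0 = 0" and ne: "\<exists>z\<in>D. stem_norm F c0 z \<noteq> 0" and "0 < e"
  obtains d where "0 < d" "\<And>c. dist c c0 < d \<Longrightarrow> \<exists>z\<in>D \<inter> ball z0 e. stem_norm F c z = 0"
proof (rule ccontr)
  assume no: "\<not> thesis"
  obtain r where r: "0 < r" "ball z0 r \<subseteq> D \<inter> ball z0 e"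
    using domainD(1)[OF dom] z0 \<open>0 < e\<close>
    by (metis IntI centre_in_ball open_Int open_ball open_contains_ball)
  \<comment> \<open>If every radius fails, there are constants tending to \<open>c0\<close> whose
    norm functions have no zero near \<open>z0\<close>; Hurwitz' theorem excludes this.\<close>
  have "\<exists>c. dist c c0 < inverse (real (Suc n)) \<and> (\<forall>z\<in>D \<inter> ball z0 e. stem_norm F c z \<noteq> 0)" for n
    using no that[of "inverse (real (Suc n))"] by (metis inverse_positive_iff_positive of_nat_0_less_iff zero_less_Suc)
  then obtain c where c: "\<And>n. dist (c n) c0 < inverse (real (Suc n))"
    "\<And>n z. z \<in> D \<inter> ball z0 e \<Longrightarrow> stem_norm F (c n) z \<noteq> 0" by metis
  have lim: "c \<longlonglongrightarrow> c0"
    using LIMSEQ_inverse_real_of_nat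
    by (rule metric_tendsto_imp_tendsto) (use c(1) in \<open>auto intro!: always_eventually less_imp_le\<close>)
  have "stem_norm F c0 z0 \<noteq> 0"
  proof (rule Hurwitz_no_zeros[of "ball z0 r" "\<lambda>n. stem_norm F (c n)" "stem_norm F c0" z0])
    have hol: "stem_norm F a holomorphic_on ball z0 r" for a
      using stem_norm_holomorphic[OF F(1)] r(2) by (blast intro: holomorphic_on_subset)
    show "stem_norm F (c n) holomorphic_on ball z0 r" for n by (rule hol)
    show "stem_norm F c0 holomorphic_on ball z0 r" by (rule hol)
    show "uniform_limit K (\<lambda>n. stem_norm F (c n)) (stem_norm F c0) sequentially"
      if K: "compact K" "K \<subseteq> ball z0 r" for K
    proof -
      have "continuous_on K F" using holomorphic_stem_continuous[OF F(1)] K r by (blast intro: continuous_on_subset)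
      then have "bounded (F ` K)"
        by (intro compact_imp_bounded compact_continuous_image K(1))
      then obtain M where M: "\<And>z. z \<in> K \<Longrightarrow> norm (F z) \<le> M"
        unfolding bounded_iff by blast
      \<comment> \<open>A bound for \<open>F\<close> on the compact set makes the estimate
        independent of \<open>z\<close>.\<close>
      have bd: "dist (stem_norm F (c n) z) (stem_norm F c0 z) \<le> 4 * \<bar>M\<bar> * norm (c n - c0) + \<bar>(norm (c n))\<^sup>2 - (norm c0)\<^sup>2\<bar>"
        if "z \<in> K" for n z
      proof -
        have "norm (stem_comp F (c n - c0) z) \<le> \<bar>fst (F z) \<bullet> (c n - c0)\<bar> + \<bar>snd (F z) \<bullet> (c n - c0)\<bar>"
          unfolding stem_comp_def using cmod_le by (metis complex.sel)
        also have "\<dots> \<le> norm (fst (F z)) * norm (c n - c0) + norm (snd (F z)) * norm (c n - c0)"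
          by (intro add_mono Cauchy_Schwarz_ineq2)
        also have "\<dots> \<le> \<bar>M\<bar> * norm (c n - c0) + \<bar>M\<bar> * norm (c n - c0)"
          using M[OF that] norm_fst_le[of "fst (F z)" "snd (F z)"] norm_snd_le[of "snd (F z)" "fst (F z)"]
          by (intro add_mono mult_right_mono) auto
        finally have 1: "norm (stem_comp F (c n - c0) z) \<le> 2 * \<bar>M\<bar> * norm (c n - c0)" by simp
        have "dist (stem_norm F (c n) z) (stem_norm F c0 z) =
          norm (- (2 * stem_comp F (c n - c0) z) + of_real ((norm (c n))\<^sup>2 - (norm c0)\<^sup>2))"
          unfolding dist_norm stem_norm_change_const[of F "c n" z c0] by simp
        also have "\<dots> \<le> norm (- (2 * stem_comp F (c n - c0) z)) + norm (complex_of_real ((norm (c n))\<^sup>2 - (norm c0)\<^sup>2))"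
          by (rule norm_triangle_ineq)
        also have "\<dots> = 2 * norm (stem_comp F (c n - c0) z) + \<bar>(norm (c n))\<^sup>2 - (norm c0)\<^sup>2\<bar>"
          unfolding norm_of_real by (simp add: norm_mult)
        finally show ?thesis using 1 by linarith
      qed
      have "(\<lambda>n. 4 * \<bar>M\<bar> * norm (c n - c0) + \<bar>(norm (c n))\<^sup>2 - (norm c0)\<^sup>2\<bar>) \<longlonglongrightarrow> 4 * \<bar>M\<bar> * norm (c0 - c0) + \<bar>(norm c0)\<^sup>2 - (norm c0)\<^sup>2\<bar>"
        by (intro tendsto_intros lim)
      then have "(\<lambda>n. 4 * \<bar>M\<bar> * norm (c n - c0) + \<bar>(norm (c n))\<^sup>2 - (norm c0)\<^sup>2\<bar>) \<longlonglongrightarrow> 0" by simp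
      then show ?thesis
        unfolding uniform_limit_iff
        by (auto dest!: order_tendstoD(2) elim!: eventually_mono intro: le_less_trans[OF bd])
    qed
    \<comment> \<open>A constant would equal the value 0 at \<open>z0\<close>, and the identity
      principle would spread it over \<open>D\<close>, against \<open>ne\<close>.\<close>
    show "\<not> stem_norm F c0 constant_on ball z0 r"
    proof
      assume "stem_norm F c0 constant_on ball z0 r"
      then have "stem_norm F c0 z = 0" if "z \<in> ball z0 r" for z
        using that z0(2) r(1) unfolding constant_on_def by (metis centre_in_ball)
      then have "stem_norm F c0 z = 0" if "z \<in> D" for z
        using symmetric_holomorphic_eq_0[OF dom stem_norm_holomorphic[OF F(1)] stem_norm_bar[OF F(2)] z0(1) r(1) _ that]
        by blast
      then show False using ne by blast
    qed
    show "stem_norm F (c n) z \<noteq> 0" if "z \<in> ball z0 r" for n z using c(2) r that by blast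
  qed (use r in auto)
  then show False using z0 by simp
qed

section \<open>Null values and factorization\<close>

lemma slice_regular_stem:
  assumes "slice_regular D f"
  obtains F where "stem_for D f F" "stem D F" "holomorphic_stem D F"
  using assms unfolding slice_regular_def stem_for_def by blast

lemma stem_for_slice_pt:
  assumes "stem_for D f F" "z \<in> D" "J \<in> \<S>"
  shows "f (slice_pt z J) = fst (F z) + J \<star> snd (F z)"
proof -
  have "slice_pt z J \<in> \<Omega> D" using assms unfolding circularization_def by blast
  then show ?thesis using assms induced_slice_pt[of D F z J] by (simp add: stem_for_def)
qed

lemma stem_for_minus_const:
  assumes "stem_for D f F"
  shows "stem_for D (\<lambda>x. f x - c) (\<lambda>z. (fst (F z) - c, snd (F z)))"
  using assms by (simp add: stem_for_def stem_def c_bar_def induced_def Let_def)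

text \<open>The mixed terms add up to a trace, so both components are real multiples of
  \<open>\<one>\<close>: the norm is a complex scalar.\<close>

lemma c_mult_ocnj:
  "c_mult u (c_ocnj u) =
     (((norm (fst u))\<^sup>2 - (norm (snd u))\<^sup>2) *\<^sub>R \<one>, (2 * (fst u \<bullet> snd u)) *\<^sub>R \<one>)"
proof -
  have "x \<star> o_cnj y + y \<star> o_cnj x = (2 * (x \<bullet> y)) *\<^sub>R \<one>" for x y
    by (simp add: o_defs prod_eq_iff inner_prod_def inner_complex_def complex_eq_iff algebra_simps)
  then show ?thesis
    by (simp add: c_mult_def c_ocnj_def o_norm_eq scaleR_left_diff_distrib)
qed

text \<open>Both stem functions in \<open>slice_norm\<close> are arbitrary choices made by
  \<open>stem_of\<close>, but on \<open>D\<close> uniqueness identifies them with \<open>G\<close>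
  and its conjugate.\<close>

lemma slice_norm_slice_pt:
  assumes F: "stem_for D f F" and D: "cnj ` D = D" and z: "z \<in> D" "J \<in> \<S>"
  shows "slice_norm D (\<lambda>x. f x - c) (slice_pt z J) = slice_pt (stem_norm F c z) J"
proof -
  define g where "g x = f x - c" for x
  define G where "G z = (fst (F z) - c, snd (F z))" for z
  have G: "stem_for D g G" unfolding g_def G_def by (rule stem_for_minus_const[OF F])
  have cnjD: "cnj z \<in> D" if "z \<in> D" for z using that D by blast
  have bar: "G (cnj z) = c_bar (G z)" if "z \<in> D" for z
    using G that unfolding stem_for_def stem_def by blast
  have sg: "stem_of D g z = G z" if "z \<in> D" for z using stem_of_eq[OF G that] .
  have "stem_for D (slice_conj D g) (\<lambda>z. c_ocnj (stem_of D g z))"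
    using sg cnjD bar by (simp add: stem_for_def stem_def slice_conj_def c_ocnj_def c_bar_def o_cnj_eq)
  then have sc: "stem_of D (slice_conj D g) z = c_ocnj (G z)" if "z \<in> D" for z
    using stem_of_eq that sg by metis
  define P where "P z = c_mult (stem_of D g z) (stem_of D (slice_conj D g) z)" for z
  have P: "P z = c_mult (G z) (c_ocnj (G z))" if "z \<in> D" for z
    using that by (simp add: P_def sg sc)
  have "stem D P"
    unfolding stem_def
  proof
    fix z assume "z \<in> D"
    then show "P (cnj z) = c_bar (P z)"
      by (simp add: P cnjD bar c_mult_ocnj) (simp add: c_bar_def)
  qed
  then have "slice_norm D g (slice_pt z J) = fst (P z) + J \<star> snd (P z)"
    unfolding slice_norm_def slice_mult_def P_def[symmetric] using induced_slice_pt z by blast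
  also have "\<dots> = slice_pt (stem_norm F c z) J"
    by (simp add: P z c_mult_ocnj o_mult_linear slice_pt_def stem_norm_def G_def)
  finally show ?thesis by (simp add: g_def[abs_def])
qed

lemma slice_norm_eq_0_iff:
  assumes F: "stem_for D f F" and D: "cnj ` D = D"
  shows "(\<forall>x\<in>\<Omega> D. slice_norm D (\<lambda>x. f x - c) x = 0) \<longleftrightarrow> (\<forall>z\<in>D. stem_norm F c z = 0)"
proof
  assume *: "\<forall>x\<in>\<Omega> D. slice_norm D (\<lambda>x. f x - c) x = 0"
  show "\<forall>z\<in>D. stem_norm F c z = 0"
  proof
    fix z assume z: "z \<in> D"
    note J = units_nonempty
    have "slice_pt (stem_norm F c z) ((\<i>, 0), (0, 0)) = 0"
      using * slice_norm_slice_pt[OF F D z J] slice_pt_in_circularization[OF D J] z by metis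
    then show "stem_norm F c z = 0" using norm_slice_pt[OF J] by (metis norm_eq_zero)
  qed
next
  assume *: "\<forall>z\<in>D. stem_norm F c z = 0"
  show "\<forall>x\<in>\<Omega> D. slice_norm D (\<lambda>x. f x - c) x = 0"
  proof
    fix x assume "x \<in> \<Omega> D"
    then obtain z J where "z \<in> D" "J \<in> \<S>" "x = slice_pt z J" unfolding circularization_def by blast
    then show "slice_norm D (\<lambda>x. f x - c) x = 0"
      using slice_norm_slice_pt[OF F D, of z J c] * by (simp add: slice_pt_def)
  qed
qed

lemma slice_constant_if_stem_const:
  assumes F: "stem_for D f F" and c: "\<And>z. z \<in> D \<Longrightarrow> F z = (c, 0)"
  shows "slice_constant D f"
proof -
  have f: "f x = c" if x: "x \<in> \<Omega> D" for x
  proof -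
    obtain z J where z: "z \<in> D" "J \<in> \<S>" "x = slice_pt z J" using x unfolding circularization_def by blast
    then show ?thesis using stem_for_slice_pt[OF F z(1,2)] c[OF z(1)] by (simp add: o_mult_linear)
  qed
  show ?thesis
    unfolding slice_constant_def by (auto simp: eventually_at_filter f)
qed

lemma stem_eq_const_iff:
  "F z = (c, 0) \<longleftrightarrow> (\<forall>b\<in>Basis. stem_comp F b z - of_real (c \<bullet> b) = 0)"
proof
  show "F z = (c, 0)" if *: "\<forall>b\<in>Basis. stem_comp F b z - of_real (c \<bullet> b) = 0"
  proof -
    have "F z = (\<lambda>_. (c, 0)) z"
      using * by (intro stem_comp_eqI) (simp add: stem_comp_def complex_eq_iff)
    then show ?thesis by simp
  qed
qed (simp add: stem_comp_def complex_eq_iff)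

text \<open>The identity principle, applied to each coordinate of \<open>F\<close> minus the
  constant.\<close>

lemma stem_const_extend:
  assumes dom: "slice_domain D \<or> product_domain D"
    and F: "stem D F" "holomorphic_stem D F"
    and z0: "z0 \<in> D" "0 < r" "\<And>z. z \<in> D \<Longrightarrow> z \<in> ball z0 r \<Longrightarrow> F z = (c, 0)"
    and z: "z \<in> D"
  shows "F z = (c, 0)"
  unfolding stem_eq_const_iff
proof
  fix b :: octonion assume b: "b \<in> Basis"
  show "stem_comp F b z - of_real (c \<bullet> b) = 0"
  proof (rule symmetric_holomorphic_eq_0[OF dom _ _ z0(1,2) _ z, of "\<lambda>z. stem_comp F b z - of_real (c \<bullet> b)"])
    show "(\<lambda>z. stem_comp F b z - of_real (c \<bullet> b)) holomorphic_on D"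
      by (intro holomorphic_intros stem_comp_holomorphic F)
    show "stem_comp F b z - of_real (c \<bullet> b) = 0" if "z \<in> D" "z \<in> ball z0 r" for z
      using z0(3)[OF that] b unfolding stem_eq_const_iff by blast
  qed (simp add: stem_comp_bar[OF F(1)])
qed

text \<open>At real points the second component of a stem function vanishes, so a null
  \<open>stem_norm\<close> forces the first one to be constant.\<close>

lemma slice_domain_null_const:
  assumes dom: "slice_domain D"
    and F: "stem D F" "holomorphic_stem D F"
    and null: "\<And>z. z \<in> D \<Longrightarrow> stem_norm F c z = 0" and z: "z \<in> D"
  shows "F z = (c, 0)"
  unfolding stem_eq_const_iff
proof
  fix b :: octonion assume b: "b \<in> Basis"
  have D: "open D" "connected D" and "D \<inter> \<real> \<noteq> {}" using dom by (auto simp: slice_domain_def)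
  then obtain x where x: "x \<in> D" "x \<in> \<real>" by blast
  show "stem_comp F b z - of_real (c \<bullet> b) = 0"
  proof (rule analytic_continuation[of "\<lambda>z. stem_comp F b z - of_real (c \<bullet> b)" D "D \<inter> \<real>" x z])
    show "(\<lambda>z. stem_comp F b z - of_real (c \<bullet> b)) holomorphic_on D"
      by (intro holomorphic_intros stem_comp_holomorphic F)
    \<comment> \<open>Small real shifts of \<open>x\<close> stay in the open set \<open>D\<close>,
      so the real points of \<open>D\<close> accumulate at \<open>x\<close>.\<close>
    show "x islimpt D \<inter> \<real>"
      unfolding islimpt_approachable
    proof safe
      fix e :: real assume "0 < e"
      obtain r where r: "0 < r" "ball x r \<subseteq> D" using D x by (metis open_contains_ball)
      define t where "t = min e r / 2"
      define y where "y = x + of_real t"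
      have "dist x y = t" "0 < t" "t < e" "t < r"
        using r \<open>0 < e\<close> unfolding y_def dist_norm by (simp_all add: t_def)
      then have "y \<in> ball x r" "dist y x < e" "y \<noteq> x" using r \<open>0 < e\<close> by (auto simp: dist_commute)
      moreover have "y \<in> \<real>" unfolding y_def using x by (simp only: Reals_add Reals_of_real)
      ultimately show "\<exists>x'\<in>D \<inter> \<real>. x' \<noteq> x \<and> dist x' x < e" using r by blast
    qed
    show "stem_comp F b y - of_real (c \<bullet> b) = 0" if "y \<in> D \<inter> \<real>" for y
    proof -
      have "y \<in> D" "cnj y = y" using that by (auto simp: Reals_cnj_iff)
      then have "F y = c_bar (F y)" using F(1) unfolding stem_def by metis
      then have "snd (F y) = - snd (F y)" unfolding c_bar_def by (metis snd_conv)
      then have "2 *\<^sub>R snd (F y) = 0" unfolding scaleR_2 by (metis add.right_inverse)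
      then have 0: "snd (F y) = 0" by simp
      then have "fst (F y) = c"
        using null[OF \<open>y \<in> D\<close>] by (simp add: stem_norm_eq_0_iff)
      with 0 have "F y = (c, 0)" by (simp add: prod_eq_iff)
      then show ?thesis using b unfolding stem_eq_const_iff by blast
    qed
  qed (use D x z in auto)
qed

section \<open>Factorization by powers of \<open>\<Delta>\<close>\<close>

text \<open>Adding the equations for \<open>J\<close> and \<open>- J\<close> isolates the first
  component; multiplying by \<open>J\<close> again recovers the second.\<close>

lemma units_affine_inject:
  assumes "\<And>J. J \<in> \<S> \<Longrightarrow> a + J \<star> b = c + J \<star> d"
  shows "a = c \<and> b = d"
proof -
  obtain J where J: "J \<in> \<S>" "- J \<in> \<S>" using units_nonempty units_uminus by metis
  have 1: "a + J \<star> b = c + J \<star> d" "a - J \<star> b = c - J \<star> d"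
    using assms[OF J(1)] assms[OF J(2)] by (simp_all add: o_mult_linear)
  have "2 *\<^sub>R a = 2 *\<^sub>R c" using arg_cong2[OF 1, of "(+)"] by (simp add: scaleR_2)
  then have "a = c" by simp
  then have "J \<star> (J \<star> b) = J \<star> (J \<star> d)" using 1 by simp
  then show ?thesis using J \<open>a = c\<close> by (simp add: units_mult_twice)
qed

text \<open>On each slice the power of \<open>\<Delta>\<close> is a complex scalar, and by the
  alternative law it multiplies the stem function of \<open>h\<close> like a scalar. Comparing all
  units \<open>J\<close> reduces the factorization to coordinates.\<close>

lemma slice_factor_iff:
  assumes F: "stem_for D f F" and H: "stem_for D h H" and D: "cnj ` D = D" and I: "I \<in> \<S>"
  shows "(\<forall>x\<in>\<Omega> D. f x - c = o_power (\<Delta> (slice_pt w I) x) n \<star> h x) \<longleftrightarrow>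
    (\<forall>z\<in>D. \<forall>b\<in>Basis. stem_comp F b z - of_real (c \<bullet> b) = ((z - w) * (z - cnj w)) ^ n * stem_comp H b z)"
    (is "?l \<longleftrightarrow> ?r")
proof -
  define G where "G = (\<lambda>z. (fst (F z) - c, snd (F z)))"
  define q where "q z = ((z - w) * (z - cnj w)) ^ n" for z
  \<comment> \<open>The complex scalar \<open>q z\<close> acting on the pair \<open>H z\<close>;
    this is the stem function of the product.\<close>
  define K where "K = (\<lambda>z. (Re (q z) *\<^sub>R fst (H z) - Im (q z) *\<^sub>R snd (H z),
                            Re (q z) *\<^sub>R snd (H z) + Im (q z) *\<^sub>R fst (H z)))"
  have lhs: "f (slice_pt z J) - c = fst (G z) + J \<star> snd (G z)" if "z \<in> D" "J \<in> \<S>" for z J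
    using stem_for_slice_pt[OF F that] by (simp add: G_def)
  have rhs: "o_power (\<Delta> (slice_pt w I) (slice_pt z J)) n \<star> h (slice_pt z J) = fst (K z) + J \<star> snd (K z)"
    if "z \<in> D" "J \<in> \<S>" for z J
  proof -
    have "o_power (\<Delta> (slice_pt w I) (slice_pt z J)) n \<star> h (slice_pt z J) =
      slice_pt (q z) J \<star> (fst (H z) + J \<star> snd (H z))"
      using that by (simp only: \<Delta>_slice_pt I o_power_slice_pt stem_for_slice_pt[OF H] q_def)
    also have "\<dots> = fst (K z) + J \<star> snd (K z)"
      using that(2) by (simp add: slice_pt_def K_def o_mult_linear units_mult_twice algebra_simps)
    finally show ?thesis .
  qed
  have "?l \<longleftrightarrow> (\<forall>z\<in>D. \<forall>J\<in>\<S>. f (slice_pt z J) - c = o_power (\<Delta> (slice_pt w I) (slice_pt z J)) n \<star> h (slice_pt z J))"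
    unfolding circularization_def by blast
  also have "\<dots> \<longleftrightarrow> (\<forall>z\<in>D. \<forall>J\<in>\<S>. fst (G z) + J \<star> snd (G z) = fst (K z) + J \<star> snd (K z))"
    using lhs rhs by simp
  also have "\<dots> \<longleftrightarrow> (\<forall>z\<in>D. G z = K z)"
    using units_affine_inject by (metis prod_eq_iff)
  also have "\<dots> \<longleftrightarrow> (\<forall>z\<in>D. \<forall>b\<in>Basis. stem_comp G b z = stem_comp K b z)"
    using stem_comp_eqI[of G _ K] by (metis stem_comp_def)
  also have "\<dots> \<longleftrightarrow> ?r"
  proof -
    have "stem_comp G b z = stem_comp F b z - of_real (c \<bullet> b)" for b z
      unfolding G_def by (rule stem_comp_minus_const)
    moreover have "stem_comp K b z = q z * stem_comp H b z" for b z
      by (simp add: K_def stem_comp_def inner_diff_left inner_add_left complex_eq_iff)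
    ultimately show ?thesis by (simp add: q_def)
  qed
  finally show ?thesis .
qed

lemma continuous_eq_0_at:
  fixes g :: "complex \<Rightarrow> complex"
  assumes "open S" "w \<in> S" "continuous_on S g" "\<And>z. z \<in> S \<Longrightarrow> z \<noteq> w \<Longrightarrow> g z = 0"
  shows "g w = 0"
proof (rule tendsto_unique[of "at w" g])
  show "g \<midarrow>w\<rightarrow> g w" using assms(1-3) by (simp add: continuous_on_eq_continuous_at isCont_def)
  have "eventually (\<lambda>z. z \<in> S - {w}) (at w)" using assms(1,2) by (rule eventually_at_in_open)
  then have "eventually (\<lambda>z. g z = 0) (at w)" by eventually_elim (use assms(4) in auto)
  then show "g \<midarrow>w\<rightarrow> 0" by (rule tendsto_eventually)
qed simp

text \<open>If \<open>n\<close> exceeded the order \<open>m\<close> of the zero, cancelling the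
  power \<open>m\<close> of \<open>z - w\<close> would force the nonvanishing cofactor
  \<open>u\<close> to vanish at \<open>w\<close>.\<close>

lemma order_of_vanishing_bounded:
  assumes "0 < r" "g holomorphic_on ball w r" "z \<in> ball w r" "g z \<noteq> 0"
  obtains m where "\<And>n k. k holomorphic_on ball w r \<Longrightarrow>
    (\<And>z. z \<in> ball w r \<Longrightarrow> g z = (z - w) ^ n * k z) \<Longrightarrow> n \<le> m"
proof (cases "g w = 0")
  case False
  have "n \<le> 0" if "\<And>z. z \<in> ball w r \<Longrightarrow> g z = (z - w) ^ n * k z" for n k
    using that[of w] False \<open>0 < r\<close> by (cases n) auto
  then show ?thesis using that by blast
next
  case True
  have nc: "\<not> g constant_on ball w r"
  proof
    assume "g constant_on ball w r"
    then have "g z = g w" using assms(1,3) unfolding constant_on_def by (metis centre_in_ball)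
    then show False using True assms(4) by simp
  qed
  obtain u s m where s: "0 < s" "ball w s \<subseteq> ball w r" "u holomorphic_on ball w s"
    "\<And>z. z \<in> ball w s \<Longrightarrow> g z = (z - w) ^ m * u z" "\<And>z. z \<in> ball w s \<Longrightarrow> u z \<noteq> 0"
    using holomorphic_factor_zero_nonconstant[OF assms(2) open_ball connected_ball _ True nc] assms(1)
    by (metis centre_in_ball)
  show ?thesis
  proof (rule that[of m], rule ccontr)
    fix n k
    assume k: "k holomorphic_on ball w r" "\<And>z. z \<in> ball w r \<Longrightarrow> g z = (z - w) ^ n * k z"
      and "\<not> n \<le> m"
    then obtain d where d: "n = m + Suc d" by (metis add_Suc_right less_imp_Suc_add not_le)
    have "u w - (w - w) ^ Suc d * k w = 0"
    proof (rule continuous_eq_0_at[of "ball w s" w "\<lambda>z. u z - (z - w) ^ Suc d * k z"])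
      show "continuous_on (ball w s) (\<lambda>z. u z - (z - w) ^ Suc d * k z)"
        using k(1) s(2,3)
        by (intro holomorphic_on_imp_continuous_on holomorphic_intros) (auto intro: holomorphic_on_subset)
      fix z assume z: "z \<in> ball w s" "z \<noteq> w"
      then have "(z - w) ^ m * u z = (z - w) ^ m * ((z - w) ^ Suc d * k z)"
        using s(2,4) k(2) unfolding d power_add by (metis mult.assoc subsetD)
      then show "u z - (z - w) ^ Suc d * k z = 0" using z by simp
    qed (use s in auto)
    then show False using s(1,5) by simp
  qed
qed

text \<open>By symmetry \<open>cnj w\<close> is a second zero, so one removable singularity is
  divided out after the other.\<close>

lemma holomorphic_divide_zero_pair:
  assumes D: "open D" "cnj ` D = D" and w: "w \<in> D" "cnj w \<noteq> w"
    and g: "g holomorphic_on D" "\<And>z. z \<in> D \<Longrightarrow> g (cnj z) = cnj (g z)" "g w = 0"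
  obtains k where "k holomorphic_on D" "\<And>z. z \<in> D \<Longrightarrow> k (cnj z) = cnj (k z)"
    "\<And>z. z \<in> D \<Longrightarrow> g z = (z - w) * (z - cnj w) * k z"
proof -
  have cnjD: "cnj z \<in> D" if "z \<in> D" for z using that D by blast
  define g1 where "g1 z = (if z = w then deriv g w else (g z - g w) / (z - w))" for z
  define g2 where "g2 z = (if z = cnj w then deriv g1 (cnj w) else (g1 z - g1 (cnj w)) / (z - cnj w))" for z
  have hol1: "g1 holomorphic_on D" unfolding g1_def by (rule pole_lemma_open[OF g(1) D(1)])
  have hol2: "g2 holomorphic_on D" unfolding g2_def by (rule pole_lemma_open[OF hol1 D(1)])
  have "g1 (cnj w) = 0" using w g by (simp add: g1_def)
  then have eq: "g z = (z - w) * (z - cnj w) * g2 z" for z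
    using g(3) g(2)[OF w(1)] by (auto simp: g2_def g1_def)
  \<comment> \<open>Averaging with the conjugate makes the symmetry hold by construction, also at
    \<open>w\<close> and \<open>cnj w\<close>.\<close>
  define k where "k z = (g2 z + cnj (g2 (cnj z))) / 2" for z
  show ?thesis
  proof (rule that[of k])
    have "cnj \<circ> g2 \<circ> cnj holomorphic_on D"
      using hol2 D by (simp add: holomorphic_on_compose_cnj_cnj)
    then have "(\<lambda>z. cnj (g2 (cnj z))) holomorphic_on D" by (simp add: o_def)
    then show "k holomorphic_on D" unfolding k_def by (intro holomorphic_intros hol2) auto
    show "k (cnj z) = cnj (k z)" for z by (simp add: k_def add.commute)
    show "g z = (z - w) * (z - cnj w) * k z" if z: "z \<in> D" for z
    proof -
      have "g z = cnj (g (cnj z))" using g(2)[OF z] by simp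
      also have "\<dots> = (z - w) * (z - cnj w) * cnj (g2 (cnj z))"
        unfolding eq[of "cnj z"] by (simp add: mult.commute)
      finally have "2 * g z = (z - w) * (z - cnj w) * (g2 z + cnj (g2 (cnj z)))"
        using eq[of z] by (simp add: distrib_left)
      then show ?thesis by (simp add: k_def field_simps)
    qed
  qed
qed

section \<open>Wings and openness\<close>

lemma o_inverse_scaleR: "o_inverse (r *\<^sub>R x) = (1 / r) *\<^sub>R o_inverse x"
  by (simp add: o_inverse_def o_cnj_linear power_mult_distrib) (simp add: power2_eq_square)

lemma o_inverse_unit:
  assumes "J \<in> \<S>" shows "o_inverse J = - J"
  using assms by (simp add: o_inverse_def o_cnj_eq o_units_iff)

lemma spherical_value_slice_pt:
  assumes "stem_for D h H" "z \<in> D" "J \<in> \<S>"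
  shows "spherical_value h (slice_pt z J) = fst (H z)"
  unfolding spherical_value_def o_cnj_slice_pt[OF assms(3)]
    stem_for_slice_pt[OF assms] stem_for_slice_pt[OF assms(1,2) units_uminus[OF assms(3)]]
  by (simp add: o_mult_linear flip: scaleR_2)

lemma spherical_deriv_slice_pt:
  assumes "stem_for D h H" "z \<in> D" "J \<in> \<S>"
  shows "spherical_deriv h (slice_pt z J) = (1 / Im z) *\<^sub>R snd (H z)"
  unfolding spherical_deriv_def o_cnj_slice_pt[OF assms(3)] o_Im_slice_pt[OF assms(3)]
    stem_for_slice_pt[OF assms] stem_for_slice_pt[OF assms(1,2) units_uminus[OF assms(3)]]
  using assms(3)
  by (simp add: o_mult_linear o_inverse_scaleR o_inverse_unit units_mult_twice flip: scaleR_2)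

text \<open>Makes the set of admissible exponents nonempty, as \<open>GREATEST\<close> in
  \<open>max_exponent\<close> requires.\<close>

lemma factors_at_zero:
  assumes "slice_regular D f"
  shows "factors_at D f c y 0 (\<lambda>x. f x - c)"
proof -
  obtain F where F: "stem_for D f F" "holomorphic_stem D F"
    using assms unfolding slice_regular_def by blast
  obtain F' :: "complex \<Rightarrow> complex \<Rightarrow>\<^sub>L c_octonion" where F': "continuous_on D F'"
    "\<And>z. z \<in> D \<Longrightarrow> (F has_derivative blinfun_apply (F' z)) (at z)"
    "\<And>z. z \<in> D \<Longrightarrow> blinfun_apply (F' z) 1 + c_iota (blinfun_apply (F' z) \<i>) = 0"
    using F(2) unfolding holomorphic_stem_def by blast
  have eq: "(\<lambda>z. (fst (F z) - c, snd (F z))) = (\<lambda>z. F z - (c, 0))"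
    by (simp add: fun_eq_iff prod_eq_iff)
  have "((\<lambda>z. F z - (c, 0)) has_derivative blinfun_apply (F' z)) (at z)" if "z \<in> D" for z
    using has_derivative_diff[OF F'(2)[OF that] has_derivative_const[of "(c, 0)"]] by simp
  then have "holomorphic_stem D (\<lambda>z. (fst (F z) - c, snd (F z)))"
    unfolding holomorphic_stem_def eq using F' by blast
  then have "slice_regular D (\<lambda>x. f x - c)"
    unfolding slice_regular_def using stem_for_minus_const[OF F(1)] by blast
  then show ?thesis by (simp add: factors_at_def)
qed

text \<open>Some coordinate of \<open>F\<close> minus the constant does not vanish identically near
  \<open>w\<close>, so its order at \<open>w\<close> is finite; exponent \<open>n\<close> makes it
  divisible by the power \<open>n\<close> of \<open>z - w\<close>.\<close>

lemma factors_at_bounded: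
  assumes dom: "product_domain D"
    and F: "stem_for D f F" "stem D F" "holomorphic_stem D F"
    and nc: "\<exists>z\<in>D. F z \<noteq> (c, 0)" and w: "w \<in> D" and I: "I \<in> \<S>"
  obtains m where "\<And>n h. factors_at D f c (slice_pt w I) n h \<Longrightarrow> n \<le> m"
proof -
  have D: "open D" "cnj ` D = D" using domainD[of D] dom by blast+
  obtain r where r: "0 < r" "ball w r \<subseteq> D" using D w by (metis open_contains_ball)
  have "\<exists>z\<in>ball w r. F z \<noteq> (c, 0)"
    using stem_const_extend[OF disjI2[OF dom] F(2,3) w r(1)] nc by blast
  then obtain z b where z: "z \<in> ball w r" "b \<in> Basis" "stem_comp F b z - of_real (c \<bullet> b) \<noteq> 0"
    unfolding stem_eq_const_iff by blast
  have "(\<lambda>z. stem_comp F b z - of_real (c \<bullet> b)) holomorphic_on ball w r"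
    by (rule holomorphic_on_subset[OF _ r(2)]) (intro holomorphic_intros stem_comp_holomorphic F)
  from order_of_vanishing_bounded[OF r(1) this z(1,3)]
  obtain m where m: "\<And>n k. k holomorphic_on ball w r \<Longrightarrow>
    (\<And>z. z \<in> ball w r \<Longrightarrow> stem_comp F b z - of_real (c \<bullet> b) = (z - w) ^ n * k z) \<Longrightarrow> n \<le> m"
    by metis
  show ?thesis
  proof (rule that[of m])
    fix n h assume h: "factors_at D f c (slice_pt w I) n h"
    then obtain H where H: "stem_for D h H" "stem D H" "holomorphic_stem D H"
      unfolding factors_at_def by (blast elim: slice_regular_stem)
    show "n \<le> m"
    proof (rule m)
      show "(\<lambda>z. (z - cnj w) ^ n * stem_comp H b z) holomorphic_on ball w r"
        by (rule holomorphic_on_subset[OF _ r(2)]) (intro holomorphic_intros stem_comp_holomorphic H)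
      have "\<forall>z\<in>D. \<forall>b\<in>Basis. stem_comp F b z - of_real (c \<bullet> b) = ((z - w) * (z - cnj w)) ^ n * stem_comp H b z"
        using h slice_factor_iff[OF F(1) H(1) D(2) I] unfolding factors_at_def by blast
      then show "stem_comp F b z - of_real (c \<bullet> b) = (z - w) ^ n * ((z - cnj w) ^ n * stem_comp H b z)"
        if "z \<in> ball w r" for z
        using that r z(2) by (auto simp: power_mult_distrib mult.assoc)
    qed
  qed
qed

text \<open>If the quotient's stem function vanishes at \<open>w\<close>, every coordinate is
  divisible by one more factor. Hence it cannot vanish there at the maximal exponent.\<close>

lemma factors_at_Suc:
  assumes D: "open D" "cnj ` D = D" and w: "w \<in> D" "cnj w \<noteq> w" and I: "I \<in> \<S>"
    and F: "stem_for D f F"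
    and h: "factors_at D f c (slice_pt w I) n h"
    and H: "stem_for D h H" "stem D H" "holomorphic_stem D H" "H w = 0"
  shows "\<exists>h. factors_at D f c (slice_pt w I) (Suc n) h"
proof -
  have "\<exists>k. k holomorphic_on D \<and> (\<forall>z\<in>D. k (cnj z) = cnj (k z)) \<and>
            (\<forall>z\<in>D. stem_comp H b z = (z - w) * (z - cnj w) * k z)" for b
  proof -
    have "stem_comp H b w = 0" using H(4) by (simp add: stem_comp_def complex_eq_iff)
    from holomorphic_divide_zero_pair[OF D w stem_comp_holomorphic[OF H(3)] stem_comp_bar[OF H(2)] this]
    show ?thesis by metis
  qed
  then obtain k where k: "\<And>b. k b holomorphic_on D" "\<And>b z. z \<in> D \<Longrightarrow> k b (cnj z) = cnj (k b z)"
    "\<And>b z. z \<in> D \<Longrightarrow> stem_comp H b z = (z - w) * (z - cnj w) * k b z" by metis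
  define K where "K = stem_assemble k"
  have K: "stem D K" "holomorphic_stem D K"
    unfolding K_def using k D by (auto intro: stem_assemble_stem holomorphic_stem_assemble)
  have sf: "stem_for D (induced K) K" using K by (simp add: stem_for_def)
  have "stem_comp F b z - of_real (c \<bullet> b) = ((z - w) * (z - cnj w)) ^ Suc n * stem_comp K b z"
    if "z \<in> D" "b \<in> Basis" for z b
  proof -
    have "stem_comp F b z - of_real (c \<bullet> b) = ((z - w) * (z - cnj w)) ^ n * stem_comp H b z"
      using h slice_factor_iff[OF F H(1) D(2) I] that unfolding factors_at_def by blast
    then show ?thesis
      using k(3)[OF that(1), of b] by (simp add: K_def stem_comp_assemble that(2))
  qed
  then have "\<forall>x\<in>\<Omega> D. f x - c = o_power (\<Delta> (slice_pt w I) x) (Suc n) \<star> induced K x"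
    using slice_factor_iff[OF F sf D(2) I] by blast
  then show ?thesis unfolding factors_at_def slice_regular_def using sf K by blast
qed

text \<open>At the maximal exponent \<open>H w\<close> is nonzero but still null, so its two
  components have equal positive length and are orthogonal. Their quotient gives the unit
  \<open>J\<close> at which \<open>h\<close>, and with it \<open>f - c\<close>, vanishes.\<close>

lemma wing_point_slice_pt:
  assumes dom: "product_domain D"
    and F: "stem_for D f F" "stem D F" "holomorphic_stem D F"
    and nc: "\<exists>z\<in>D. F z \<noteq> (c, 0)" and null: "\<forall>z\<in>D. stem_norm F c z = 0"
    and w: "w \<in> upper_part D"
  shows "\<exists>J\<in>\<S>. wing_point D f c w = slice_pt w J \<and> f (slice_pt w J) = c"
proof -
  have D: "open D" "cnj ` D = D" using domainD[of D] dom by blast+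
  have wD: "w \<in> D" "0 < Im w" using w product_domain_upper_part(1)[OF dom] by auto
  then have wc: "cnj w \<noteq> w" by (simp add: complex_eq_iff)
  have reg: "slice_regular D f" using F unfolding slice_regular_def by blast
  have exp: "(\<exists>h. factors_at D f c (slice_pt w I) (max_exponent D f c (slice_pt w I)) h) \<and>
      (\<forall>n h. factors_at D f c (slice_pt w I) n h \<longrightarrow> n \<le> max_exponent D f c (slice_pt w I))"
    if "I \<in> \<S>" for I
  proof -
    obtain m where "\<And>n h. factors_at D f c (slice_pt w I) n h \<Longrightarrow> n \<le> m"
      using factors_at_bounded[OF dom F nc wD(1) \<open>I \<in> \<S>\<close>] by metis
    then show ?thesis
      unfolding max_exponent_def
      using GreatestI_nat[of "\<lambda>n. \<exists>h. factors_at D f c (slice_pt w I) n h" 0 m]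
        Greatest_le_nat[of "\<lambda>n. \<exists>h. factors_at D f c (slice_pt w I) n h" _ m]
        factors_at_zero[OF reg] by blast
  qed
  define P where "P v \<longleftrightarrow> (\<exists>I\<in>\<S>. \<exists>h.
        factors_at D f c (slice_pt w I) (max_exponent D f c (slice_pt w I)) h \<and>
        v = Re w *\<^sub>R \<one> -
            spherical_value h (slice_pt w I) \<star> o_inverse (spherical_deriv h (slice_pt w I)))" for v
  \<comment> \<open>The choice in \<open>wing_point\<close> may pick any admissible \<open>I\<close>
    and \<open>h\<close>; what follows applies to whichever it picks.\<close>
  have "\<exists>v. P v" unfolding P_def using exp units_nonempty by blast
  then have "P (wing_point D f c w)"
    unfolding wing_point_def P_def[symmetric] by (rule someI_ex)
  then obtain I h where I: "I \<in> \<S>"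
    and h: "factors_at D f c (slice_pt w I) (max_exponent D f c (slice_pt w I)) h"
    and v: "wing_point D f c w = Re w *\<^sub>R \<one> -
            spherical_value h (slice_pt w I) \<star> o_inverse (spherical_deriv h (slice_pt w I))"
    unfolding P_def by blast
  define n where "n = max_exponent D f c (slice_pt w I)"
  obtain H where H: "stem_for D h H" "stem D H" "holomorphic_stem D H"
    using h unfolding factors_at_def by (blast elim: slice_regular_stem)
  have comp: "stem_comp F b z - of_real (c \<bullet> b) = ((z - w) * (z - cnj w)) ^ n * stem_comp H b z"
    if "z \<in> D" "b \<in> Basis" for z b
    using h slice_factor_iff[OF F(1) H(1) D(2) I] that unfolding factors_at_def n_def by blast
  have "H w \<noteq> 0"
  proof
    assume "H w = 0"
    then obtain h' where "factors_at D f c (slice_pt w I) (Suc n) h'"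
      using factors_at_Suc[OF D wD(1) wc I F(1) h H] n_def by blast
    then show False using exp[OF I] n_def by (metis not_less_eq_eq order_refl)
  qed
  have "stem_norm H 0 w = 0"
  \<comment> \<open>With \<open>cnj w\<close> removed, \<open>w\<close> is the only point where the
    divisor may vanish; the null condition extends to it by continuity.\<close>
  proof (rule continuous_eq_0_at[of "D - {cnj w}" w "stem_norm H 0"])
    show "continuous_on (D - {cnj w}) (stem_norm H 0)"
      using stem_norm_holomorphic[OF H(3)]
      by (blast intro: holomorphic_on_imp_continuous_on holomorphic_on_subset)
    fix z assume z: "z \<in> D - {cnj w}" "z \<noteq> w"
    define q where "q = ((z - w) * (z - cnj w)) ^ n"
    have "0 = stem_norm F c z" using null z by simp
    also have "\<dots> = (\<Sum>b\<in>Basis. (q * stem_comp H b z)\<^sup>2)"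
      unfolding stem_norm_eq_sum q_def using comp z by (intro sum.cong) auto
    also have "\<dots> = q\<^sup>2 * stem_norm H 0 z"
      unfolding stem_norm_eq_sum by (simp add: power_mult_distrib sum_distrib_left)
    finally show "stem_norm H 0 z = 0" using z by (simp add: q_def)
  qed (use D wD wc in \<open>auto simp: open_delete\<close>)
  then have nrm: "norm (fst (H w)) = norm (snd (H w))" "fst (H w) \<bullet> snd (H w) = 0"
    by (simp_all add: stem_norm_eq_0_iff)
  then have nz: "snd (H w) \<noteq> 0" using \<open>H w \<noteq> 0\<close> by (metis norm_eq_zero prod_eq_iff fst_zero snd_zero)
  define J where "J = - (fst (H w) \<star> o_inverse (snd (H w)))"
  have J: "J \<in> \<S>" unfolding J_def by (rule units_quotient[OF nz nrm])
  \<comment> \<open>The spherical derivative is \<open>snd (H w)\<close> divided by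
    \<open>Im w\<close>, so inverting it puts the factor \<open>Im w\<close> in front of
    \<open>J\<close>.\<close>
  have "wing_point D f c w = slice_pt w J"
    unfolding v spherical_value_slice_pt[OF H(1) wD(1) I] spherical_deriv_slice_pt[OF H(1) wD(1) I]
    by (simp add: o_inverse_scaleR o_mult_linear slice_pt_def J_def)
  moreover have "f (slice_pt w J) = c"
  proof -
    have "J \<star> snd (H w) = - fst (H w)"
      using nz by (simp add: J_def o_mult_linear o_inverse_cancel)
    then have "h (slice_pt w J) = 0" using stem_for_slice_pt[OF H(1) wD(1) J] by simp
    moreover have "slice_pt w J \<in> \<Omega> D" using slice_pt_in_circularization[OF D(2) J] wD by blast
    ultimately have "f (slice_pt w J) - c = 0"
      using h unfolding factors_at_def by (metis o_mult_linear(10))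
    then show ?thesis by simp
  qed
  ultimately show ?thesis using J by blast
qed

section \<open>Null values, wings and images of spheres\<close>

text \<open>The constants \<open>c\<close> for which the slice norm of \<open>f - c\<close>
  vanishes, read off from the stem function. That they are values of \<open>f\<close> follows from
  \<open>f_image_iff\<close>.\<close>

definition null_values :: "complex set \<Rightarrow> (complex \<Rightarrow> c_octonion) \<Rightarrow> octonion set" where
  "null_values D F = {c. \<forall>z\<in>D. stem_norm F c z = 0}"

lemma closed_null_values: "closed (null_values D F)"
proof -
  have "null_values D F = (\<Inter>z\<in>D. {c. stem_norm F c z = 0})" by (auto simp: null_values_def)
  moreover have "closed {c. stem_norm F c z = 0}" for z
    unfolding stem_norm_eq_sum
    by (intro closed_Collect_eq continuous_intros)
  ultimately show ?thesis by auto
qed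

context
  fixes D f F
  assumes dom: "slice_domain D \<or> product_domain D"
    and F: "stem_for D f F" "stem D F" "holomorphic_stem D F"
    and nsc: "\<not> slice_constant D f"
begin

lemma stem_not_const: "\<exists>z\<in>D. F z \<noteq> (c, 0)"
  using slice_constant_if_stem_const[OF F(1)] nsc by blast

lemma null_values_product_domain:
  assumes "c \<in> null_values D F"
  shows "product_domain D"
  using dom slice_domain_null_const[OF _ F(2,3), of c] stem_not_const[of c] assms
  unfolding null_values_def by blast

text \<open>The sphere criterion \<open>slice_sphere_image\<close> makes taking the value
  \<open>c\<close> the same as a zero of a holomorphic function, to which Hurwitz' theorem
  applies.\<close>

lemma f_image_iff:
  assumes "E \<subseteq> D"
  shows "c \<in> f ` \<Omega> E \<longleftrightarrow> (\<exists>z\<in>E. stem_norm F c z = 0)"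
proof -
  have "c \<in> f ` \<Omega> E \<longleftrightarrow> (\<exists>z\<in>E. \<exists>J\<in>\<S>. c = f (slice_pt z J))"
    unfolding circularization_def by blast
  also have "\<dots> \<longleftrightarrow> (\<exists>z\<in>E. \<exists>J\<in>\<S>. c = fst (F z) + J \<star> snd (F z))"
    using stem_for_slice_pt[OF F(1)] assms by (metis subsetD)
  finally show ?thesis by (simp only: slice_sphere_image stem_norm_eq_0_iff)
qed

lemma wings_eq: "wings D f = (\<Union>c\<in>null_values D F. wing D f c)"
proof -
  have "c \<in> f ` \<Omega> D" if "c \<in> null_values D F" for c
    using that dom f_image_iff[of D c]
    by (auto simp: null_values_def slice_domain_def product_domain_def)
  then have "{c \<in> f ` \<Omega> D. \<forall>x\<in>\<Omega> D. slice_norm D (\<lambda>y. f y - c) x = 0} = null_values D F"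
    unfolding slice_norm_eq_0_iff[OF F(1) domainD(2)[OF dom]] by (auto simp: null_values_def)
  then show ?thesis by (simp add: wings_def)
qed

text \<open>Every null value contributes a nonempty wing, because the upper component is
  nonempty.\<close>

lemma wings_empty_iff: "wings D f = {} \<longleftrightarrow> null_values D F = {}"
  unfolding wings_eq using null_values_product_domain product_domain_upper_part(3)
  by (fastforce simp: wing_def)

lemma wings_null_value:
  assumes "x \<in> wings D f"
  shows "f x \<in> null_values D F"
proof -
  obtain c w where c: "c \<in> null_values D F" and w: "w \<in> upper_part D" "x = wing_point D f c w"
    using assms unfolding wings_eq wing_def by blast
  then show ?thesis
    using wing_point_slice_pt[OF null_values_product_domain[OF c] F stem_not_const _ w(1), of c]
    unfolding null_values_def by auto
qed

text \<open>Where \<open>snd (F z) \<noteq> 0\<close>, the slice function is injective on the sphere through \<open>z\<close>, so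
  the point of the wing on this sphere is the given preimage.\<close>

lemma null_value_wings:
  assumes "z \<in> D" "J \<in> \<S>" "snd (F z) \<noteq> 0" "f (slice_pt z J) \<in> null_values D F"
  shows "slice_pt z J \<in> wings D f"
proof -
  define c where "c = f (slice_pt z J)"
  note c = assms(4)[folded c_def]
  have P: "product_domain D" using null_values_product_domain[OF c] .
  have *: "slice_pt w I \<in> wings D f"
    if w: "w \<in> D" "0 < Im w" "I \<in> \<S>" "snd (F w) \<noteq> 0" "f (slice_pt w I) = c" for w I
  proof -
    have up: "w \<in> upper_part D" using product_domain_upper_part(1)[OF P] w by auto
    obtain K where K: "K \<in> \<S>" "wing_point D f c w = slice_pt w K" "f (slice_pt w K) = c"
      using wing_point_slice_pt[OF P F stem_not_const _ up, of c] c unfolding null_values_def by auto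
    have "fst (F w) + K \<star> snd (F w) = fst (F w) + I \<star> snd (F w)"
      using K(3) w(5) stem_for_slice_pt[OF F(1) w(1)] K(1) w(3) by metis
    then have "K = I" using o_mult_cancel_right[OF w(4)] by simp
    then show ?thesis using K(2) c up unfolding wings_eq wing_def by (metis UN_I imageI)
  qed
  have "Im z \<noteq> 0" using P assms(1) by (auto simp: product_domain_def complex_is_Real_iff)
  \<comment> \<open>A point with \<open>z\<close> in the lower half-plane is rewritten with
    \<open>cnj z\<close> and \<open>- J\<close>.\<close>
  then consider "0 < Im z" | "0 < Im (cnj z)" by fastforce
  then show ?thesis
  proof cases
    case 1 then show ?thesis using * assms c_def by blast
  next
    case 2
    have "snd (F (cnj z)) \<noteq> 0" using F(2) assms(1,3) by (simp add: stem_def c_bar_def)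
    moreover have "slice_pt (cnj z) (- J) = slice_pt z J" by (simp add: slice_pt_cnj)
    ultimately show ?thesis
      using *[OF domainD(3)[OF dom assms(1)] 2 units_uminus[OF assms(2)]] c_def by simp
  qed
qed

lemma degenerate_iff:
  assumes "z \<in> D" "Im z \<noteq> 0" "J \<in> \<S>"
  shows "slice_pt z J \<in> degenerate_set D f \<longleftrightarrow> snd (F z) = 0"
proof -
  have "slice_pt z J \<notin> o_reals"
  proof
    assume "slice_pt z J \<in> o_reals"
    then obtain r where "slice_pt z J = r *\<^sub>R \<one>" by (auto simp: o_reals_def)
    then have "o_Im (slice_pt z J) = 0" by (simp add: o_Im_def o_Re_eq)
    then show False using assms by (auto simp: o_Im_slice_pt o_units_iff)
  qed
  moreover have "slice_pt z J \<in> \<Omega> D" using assms unfolding circularization_def by blast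
  ultimately show ?thesis
    using assms by (simp add: degenerate_set_def spherical_deriv_slice_pt[OF F(1) assms(1,3)])
qed

lemma image_neighbourhood:
  assumes E: "E \<subseteq> D" "open E" "z0 \<in> E" and c0: "stem_norm F c0 z0 = 0" "c0 \<notin> null_values D F"
  obtains d where "0 < d" "\<And>c. dist c c0 < d \<Longrightarrow> \<exists>z\<in>E. stem_norm F c z = 0"
proof -
  obtain e where e: "0 < e" "ball z0 e \<subseteq> E" using E by (metis open_contains_ball)
  obtain d where "0 < d" "\<And>c. dist c c0 < d \<Longrightarrow> \<exists>z\<in>D \<inter> ball z0 e. stem_norm F c z = 0"
    using stem_norm_zero_stable[OF dom F(3,2) _ c0(1) _ e(1)] c0(2) E unfolding null_values_def by blast
  then show ?thesis using that[of d] e by blast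
qed

text \<open>A circular set contains whole spheres, so finding a suitable \<open>z\<close> already
  produces a preimage.\<close>

lemma open_image_circular:
  assumes "null_values D F = {}" "circular U" "openin (top_of_set (\<Omega> D)) U"
  shows "open (f ` U)"
proof -
  obtain E0 where E0: "U = \<Omega> E0" using assms(2) by (auto simp: circular_def)
  have opU: "open U"
    using assms(3) open_circularization[OF domainD(2)[OF dom] domainD(1)[OF dom]] by (metis openin_open_eq)
  obtain K where K: "K \<in> \<S>" using units_nonempty by blast
  \<comment> \<open>The set behind \<open>circular\<close> may fail to be open. The trace of
    \<open>U\<close> on one slice adds the conjugates and is open.\<close>
  define E where "E = (\<lambda>z. slice_pt z K) -` U"
  have opE: "open E" unfolding E_def slice_pt_def
    by (intro open_vimage opU) (auto intro!: continuous_intros)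
  have "U \<subseteq> \<Omega> D" using assms(3) openin_imp_subset by blast
  then have ED: "E \<subseteq> D" unfolding E_def using slice_pt_in_circularization[OF domainD(2)[OF dom] K] by blast
  have UE: "U = \<Omega> E"
  proof -
    have "x \<in> U \<longleftrightarrow> x \<in> \<Omega> E" for x
    proof -
      obtain z J where "J \<in> \<S>" "x = slice_pt z J" by (metis octonion_eq_slice_pt)
      then show ?thesis using K by (simp add: E0 E_def slice_pt_in_circularization_iff disj_commute)
    qed
    then show ?thesis by blast
  qed
  show ?thesis
    unfolding open_dist UE
  proof
    fix c0 assume "c0 \<in> f ` \<Omega> E"
    then obtain z0 where z0: "z0 \<in> E" "stem_norm F c0 z0 = 0" unfolding f_image_iff[OF ED] by blast
    from image_neighbourhood[OF ED opE z0] assms(1)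
    obtain d where "0 < d" "\<And>c. dist c c0 < d \<Longrightarrow> \<exists>z\<in>E. stem_norm F c z = 0" by blast
    then show "\<exists>e>0. \<forall>y. dist y c0 < e \<longrightarrow> y \<in> f ` \<Omega> E" unfolding f_image_iff[OF ED] by blast
  qed
qed

text \<open>Near a nondegenerate point the imaginary unit \<open>J\<close> with \<open>c = fst (F z) + J \<star> snd (F z)\<close>
  depends continuously on \<open>c\<close> and \<open>z\<close>.\<close>

lemma nonreal_neighbourhood:
  assumes z0: "z0 \<in> D" "snd (F z0) \<noteq> 0" and J0: "J0 \<in> \<S>" and V: "open V" "slice_pt z0 J0 \<in> V"
    and c0: "f (slice_pt z0 J0) \<notin> null_values D F"
  obtains d where "0 < d" "\<And>c. dist c (f (slice_pt z0 J0)) < d \<Longrightarrow>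
     \<exists>z J. z \<in> D \<and> J \<in> \<S> \<and> slice_pt z J \<in> V \<and> f (slice_pt z J) = c"
proof -
  define c0 where "c0 = f (slice_pt z0 J0)"
  have c0_eq: "c0 = fst (F z0) + J0 \<star> snd (F z0)" unfolding c0_def by (rule stem_for_slice_pt[OF F(1) z0(1) J0])
  \<comment> \<open>The unit is the quotient solving
    \<open>c = fst (F z) + J \<star> snd (F z)\<close>. It lies in \<open>\<S>\<close> only at zeros
    of \<open>stem_norm F c\<close>, but the formula is continuous around
    \<open>(z0, c0)\<close>.\<close>
  define \<Phi> where "\<Phi> p = slice_pt (fst p) (- ((fst (F (fst p)) - snd p) \<star> o_inverse (snd (F (fst p)))))"
    for p :: "complex \<times> octonion"
  have J0_eq: "- ((fst (F z0) - c0) \<star> o_inverse (snd (F z0))) = J0"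
    using o_mult_cancel_right[OF z0(2)] z0(2) by (simp add: c0_eq o_mult_linear o_inverse_cancel)
  have bb: "bounded_bilinear (\<star>)"
  proof
    show "\<exists>K. \<forall>a b. norm (a \<star> b) \<le> norm a * norm b * K"
      by (rule exI[of _ 1]) (simp add: o_norm_mult)
  qed (simp_all add: o_mult_linear)
  have "isCont F z0"
    using holomorphic_stem_continuous[OF F(3)] domainD(1)[OF dom] z0(1) by (simp add: continuous_on_eq_continuous_at)
  then have Ft: "((\<lambda>p. F (fst p)) \<longlongrightarrow> F z0) (at (z0, c0))"
    by (rule isCont_tendsto_compose) (intro tendsto_eq_intros | simp)+
  have proj: "(fst \<longlongrightarrow> z0) (at (z0, c0))" "(snd \<longlongrightarrow> c0) (at (z0, c0))"
    using tendsto_fst[OF tendsto_ident_at[of "(z0, c0)" UNIV]]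
      tendsto_snd[OF tendsto_ident_at[of "(z0, c0)" UNIV]] by simp_all
  have "(\<Phi> \<longlongrightarrow> \<Phi> (z0, c0)) (at (z0, c0))"
    unfolding \<Phi>_def slice_pt_def o_inverse_def o_cnj_eq
    using z0(2) by (auto intro!: tendsto_intros Ft proj bounded_bilinear.tendsto[OF bb])
  then have "eventually (\<lambda>p. \<Phi> p \<in> V) (at (z0, c0))"
    by (rule topological_tendstoD) (use V J0_eq in \<open>simp_all add: \<Phi>_def\<close>)
  moreover have "eventually (\<lambda>p. snd (F (fst p)) \<noteq> 0) (at (z0, c0))"
    using tendsto_imp_eventually_ne[OF tendsto_snd[OF Ft] z0(2)] .
  ultimately have "eventually (\<lambda>p. \<Phi> p \<in> V \<and> snd (F (fst p)) \<noteq> 0) (nhds (z0, c0))"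
    using V(2) J0_eq z0(2) unfolding eventually_nhds_conv_at by (auto simp: \<Phi>_def elim: eventually_elim2)
  then obtain W where W: "open W" "(z0, c0) \<in> W" "\<forall>p\<in>W. \<Phi> p \<in> V \<and> snd (F (fst p)) \<noteq> 0"
    unfolding eventually_nhds by blast
  \<comment> \<open>A product neighbourhood decouples the variables: Hurwitz' theorem supplies
    \<open>z\<close> in \<open>A\<close> for each \<open>c\<close> close to \<open>c0\<close>, and
    \<open>B\<close> bounds \<open>c\<close>.\<close>
  from W(1,2) obtain A B where AB: "open A" "open B" "(z0, c0) \<in> A \<times> B" and "A \<times> B \<subseteq> W"
    by (rule open_prod_elim)
  have AB_in: "\<Phi> (z, c) \<in> V \<and> snd (F z) \<noteq> 0" if "z \<in> A" "c \<in> B" for z c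
  proof -
    have "(z, c) \<in> W" using that \<open>A \<times> B \<subseteq> W\<close> by blast
    from bspec[OF W(3) this] show ?thesis by simp
  qed
  have z0A: "z0 \<in> A" and c0B: "c0 \<in> B" using AB(3) by blast+
  have "stem_norm F c0 z0 = 0"
    using slice_sphere_image[of c0] c0_eq J0 unfolding stem_norm_eq_0_iff by blast
  then obtain d1 where d1: "0 < d1" "\<And>c. dist c c0 < d1 \<Longrightarrow> \<exists>z\<in>D \<inter> A. stem_norm F c z = 0"
    using image_neighbourhood[of "D \<inter> A" z0 c0] c0[folded c0_def] AB(1) z0A z0(1) domainD(1)[OF dom] by blast
  obtain d2 where d2: "0 < d2" "ball c0 d2 \<subseteq> B" using AB(2) c0B by (metis open_contains_ball)
  show ?thesis
  proof (rule that[of "min d1 d2"])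
    fix c assume "dist c (f (slice_pt z0 J0)) < min d1 d2"
    then have c: "dist c c0 < d1" "c \<in> B" using d2 by (auto simp: c0_def dist_commute)
    then obtain z where z: "z \<in> D" "z \<in> A" "stem_norm F c z = 0" using d1 by blast
    define J where "J = - ((fst (F z) - c) \<star> o_inverse (snd (F z)))"
    have nz: "snd (F z) \<noteq> 0" "slice_pt z J \<in> V" using AB_in[OF z(2) c(2)] by (simp_all add: \<Phi>_def J_def)
    have J: "J \<in> \<S>" unfolding J_def using z(3) nz(1) by (intro units_quotient) (simp_all add: stem_norm_eq_0_iff)
    have "f (slice_pt z J) = c"
      unfolding stem_for_slice_pt[OF F(1) z(1) J] using nz(1)
      by (simp add: J_def o_mult_linear o_inverse_cancel)
    then show "\<exists>z J. z \<in> D \<and> J \<in> \<S> \<and> slice_pt z J \<in> V \<and> f (slice_pt z J) = c"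
      using z J nz by blast
  qed (use d1 d2 in simp)
qed

text \<open>The sphere through a real point is that point alone, so all nearby spheres lie entirely
  in \<open>V\<close> and every unit \<open>J\<close> is admissible.\<close>

lemma real_neighbourhood:
  assumes z0: "z0 \<in> D" "Im z0 = 0" and J0: "J0 \<in> \<S>" and V: "open V" "slice_pt z0 J0 \<in> V"
    and c0: "f (slice_pt z0 J0) \<notin> null_values D F"
  obtains d where "0 < d" "\<And>c. dist c (f (slice_pt z0 J0)) < d \<Longrightarrow>
     \<exists>z J. z \<in> D \<and> J \<in> \<S> \<and> slice_pt z J \<in> V \<and> f (slice_pt z J) = c"
proof -
  define c0 where "c0 = f (slice_pt z0 J0)"
  obtain e where e: "0 < e" "ball (slice_pt z0 J0) e \<subseteq> V" using V by (metis open_contains_ball)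
  have inV: "slice_pt z J \<in> V" if "z \<in> ball z0 e" "J \<in> \<S>" for z J
  proof -
    have "slice_pt z0 J0 = slice_pt z0 J" using z0(2) by (simp add: slice_pt_def)
    moreover have "slice_pt z0 J - slice_pt z J = slice_pt (z0 - z) J"
      by (simp add: slice_pt_def algebra_simps)
    ultimately have "dist (slice_pt z0 J0) (slice_pt z J) = norm (slice_pt (z0 - z) J)"
      by (simp only: dist_norm)
    then show ?thesis using that e by (auto simp: norm_slice_pt dist_norm)
  qed
  have "stem_norm F c0 z0 = 0"
    using slice_sphere_image[of c0] stem_for_slice_pt[OF F(1) z0(1) J0] J0
    unfolding stem_norm_eq_0_iff c0_def by blast
  then obtain d where d: "0 < d" "\<And>c. dist c c0 < d \<Longrightarrow> \<exists>z\<in>D \<inter> ball z0 e. stem_norm F c z = 0"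
    using image_neighbourhood[of "D \<inter> ball z0 e" z0 c0] c0[folded c0_def] e z0(1) domainD(1)[OF dom]
    by (metis IntI Int_lower1 centre_in_ball open_Int open_ball)
  show ?thesis
  proof (rule that[of d])
    fix c assume "dist c (f (slice_pt z0 J0)) < d"
    then have "c \<in> f ` \<Omega> (D \<inter> ball z0 e)" using d(2) f_image_iff[of "D \<inter> ball z0 e"] c0_def by blast
    then show "\<exists>z J. z \<in> D \<and> J \<in> \<S> \<and> slice_pt z J \<in> V \<and> f (slice_pt z J) = c"
      unfolding circularization_def using inV by blast
  qed (rule d)
qed

text \<open>Preimages of nearby values come from the two neighbourhood lemmas; what remains is that
  they stay off the removed sets.\<close>

lemma open_map_restricted:
  "open_map (top_of_set (\<Omega> D - (degenerate_closure D f \<union> wings D f))) euclidean f"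
proof -
  define A where "A = \<Omega> D - (degenerate_closure D f \<union> wings D f)"
  have "open (f ` U)" if U: "openin (top_of_set A) U" for U
    unfolding open_dist
  proof
    fix c0 assume "c0 \<in> f ` U"
    then obtain x0 where x0: "x0 \<in> U" "c0 = f x0" by blast
    obtain T where T: "open T" "U = A \<inter> T" using U by (metis openin_open)
    have "x0 \<in> \<Omega> D" using x0 T A_def by blast
    then obtain z0 J0 where z0: "z0 \<in> D" "J0 \<in> \<S>" "x0 = slice_pt z0 J0" unfolding circularization_def by blast
    \<comment> \<open>Still open, and preimages found in it avoid the closure of the degenerate
      set.\<close>
    define V where "V = T - closure (degenerate_set D f)"
    have V: "open V" "slice_pt z0 J0 \<in> V"
      using T x0 z0(3) \<open>x0 \<in> \<Omega> D\<close> by (auto simp: V_def A_def degenerate_closure_def)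
    have "x0 \<notin> degenerate_set D f" using V(2) z0(3) closure_subset unfolding V_def by blast
    then have nd: "Im z0 = 0 \<or> snd (F z0) \<noteq> 0" using degenerate_iff z0 by blast
    have c0: "f (slice_pt z0 J0) \<notin> null_values D F"
    proof
      assume *: "f (slice_pt z0 J0) \<in> null_values D F"
      then have "D \<inter> \<real> = {}" using null_values_product_domain by (simp add: product_domain_def)
      then have "Im z0 \<noteq> 0" using z0(1) by (auto simp: complex_is_Real_iff)
      then have "x0 \<in> wings D f" using null_value_wings[OF z0(1,2) _ *] nd z0(3) by blast
      then show False using x0 T A_def by blast
    qed
    obtain d1 where d1: "0 < d1" "\<And>c. dist c c0 < d1 \<Longrightarrow>
      \<exists>z J. z \<in> D \<and> J \<in> \<S> \<and> slice_pt z J \<in> V \<and> f (slice_pt z J) = c"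
      using nd real_neighbourhood[OF z0(1) _ z0(2) V c0] nonreal_neighbourhood[OF z0(1) _ z0(2) V c0]
      unfolding x0(2) z0(3) by metis
    \<comment> \<open>Null values form a closed set and wings are mapped into it, so preimages of
      values near \<open>c0\<close> lie on no wing.\<close>
    obtain d2 where d2: "0 < d2" "ball c0 d2 \<subseteq> - null_values D F"
      using closed_null_values c0 x0(2) z0(3) by (metis ComplI open_Compl open_contains_ball)
    have "c \<in> f ` U" if "dist c c0 < min d1 d2" for c
    proof -
      have c: "dist c c0 < d1" "c \<notin> null_values D F" using that d2 by (auto simp: dist_commute)
      then obtain z J where z: "z \<in> D" "J \<in> \<S>" "slice_pt z J \<in> V" "f (slice_pt z J) = c" using d1 by blast
      then have "slice_pt z J \<in> \<Omega> D" unfolding circularization_def by blast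
      moreover have "slice_pt z J \<notin> wings D f" using wings_null_value z(4) c(2) by blast
      ultimately have "slice_pt z J \<in> U" using z(3) unfolding T(2) A_def V_def degenerate_closure_def by blast
      then show ?thesis using z(4) by blast
    qed
    then show "\<exists>e>0. \<forall>y. dist y c0 < e \<longrightarrow> y \<in> f ` U" using d1(1) d2(1) by (intro exI[of _ "min d1 d2"]) auto
  qed
  then show ?thesis unfolding A_def[symmetric] open_map_def by (simp add: open_openin[symmetric])
qed

end

theorem theorem6p8:
  fixes D :: "complex set" and f :: "octonion \<Rightarrow> octonion"
  assumes "slice_domain D \<or> product_domain D"
    and "slice_regular D f"
    and "\<not> slice_constant D f"
  shows "open_map (top_of_set (\<Omega> D - (degenerate_closure D f \<union> wings D f))) euclidean f \<and>
         (wings D f = {} \<longrightarrow>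
            (\<forall>U. circular U \<and> openin (top_of_set (\<Omega> D)) U \<longrightarrow> open (f ` U)) \<and>
            open (f ` \<Omega> D))"
proof -
  obtain F where F: "stem_for D f F" "stem D F" "holomorphic_stem D F"
    using assms(2) by (rule slice_regular_stem)
  note ctx = assms(1) F assms(3)
  have "open (f ` U)" if "wings D f = {}" "circular U" "openin (top_of_set (\<Omega> D)) U" for U
    using open_image_circular[OF ctx _ that(2,3)] that(1) wings_empty_iff[OF ctx] by blast
  moreover have "circular (\<Omega> D)" "openin (top_of_set (\<Omega> D)) (\<Omega> D)"
    by (auto simp: circular_def)
  ultimately show ?thesis using open_map_restricted[OF ctx] by blast
qed

end
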